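(* Let $\alpha>0$, $r>0$, $G(x_1,x_2)=x_1\vee\alpha x_2$, $\Delta:=\{x\in\mathbb R_+^2:x_1=\alpha x_2\}$, $n:=(1,-\alpha)$, and $q(x):=n^\top a(x)n$, where $\mu$, $a$, $c$ and $\mathcal L$ are as in the context. Then the stopping-gain measure $\Gamma:=c+rG-\mathcal LG$ decomposes as $$\Gamma=\Gamma^{\rm ac}\,dx+\Gamma^\Delta,$$ where, on $\mathcal R_1:=\{x\in\mathbb R_+^2:x_1>\alpha x_2\}$ and $\mathcal R_2:=\{x\in\mathbb R_+^2:x_1<\alpha x_2\}$, $$\Gamma^{\rm ac}(x)=\begin{cases}c(x)+rx_1-\mu_1(x),&x\in\mathcal R_1,\\ c(x)+r\alpha x_2-\alpha\mu_2(x),&x\in\mathcal R_2,\end{cases}$$ and the singular diagonal component is $$\Gamma^\Delta(dx)=-\frac{n^\top a(x)n}{2\sqrt{1+\alpha^2}}\,\sigma_\Delta(dx)=-\frac{q(x)}{2\sqrt{1+\alpha^2}}\,\sigma_\Delta(dx),$$ with $\sigma_\Delta$ the one-dimensional surface (arc-length) measure on $\Delta$. Equivalently, for every bounded Borel function $F$ (for which the integrals are defined), $$\int_{\mathbb R_+^2}F(x)\,\Gamma^\Delta(dx)=-\frac1{2\sqrt{1+\alpha^2}}\int_\Delta F(x)q(x)\,\sigma_\Delta(dx).$$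
   Context: $\mathbb R_+^2=[0,\infty)^2$, $\mathbb R_{++}^2=(0,\infty)^2$. The coefficients $\mu:\mathbb R_+^2\to\mathbb R^2$ and $\sigma:\mathbb R_+^2\to\mathbb R^{2\times2}$ are locally Lipschitz with at most linear growth, $a=\sigma\sigma^\top$ is locally uniformly elliptic in $\mathbb R_{++}^2$ (uniformly on compact subsets), and $c:\mathbb R_+^2\to[0,\infty)$ is continuous. The operator is $\mathcal Lf=\sum_{i=1}^2\mu_i\partial_if+\frac12\sum_{i,j=1}^2a_{ij}\partial_{ij}f$; it is the interior generator of the diffusion $dX_t=\mu(X_t)dt+\sigma(X_t)dW_t+dL_t$ normally reflected on the axes of $\mathbb R_+^2$. Since $G$ is Lipschitz and piecewise affine but not $C^2$ across $\Delta$, $\mathcal LG$ is understood distributionally in the interior $\mathbb R_{++}^2$: $\partial_iG$ is the a.e. derivative, $\partial_{ij}G$ is the distributional second derivative (a signed Radon measure), and $a_{ij}\partial_{ij}G$ is the product of this measure with the continuous function $a_{ij}$. Thus $\Gamma$ is a signed Radon measure (locally finite, sign-indefinite), and it gives no mass to the coordinate axes. *)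

theory Defs
  imports "HOL-Analysis.Analysis"
begin

section \<open>Signed Radon measures\<close>

definition relatively_compact_borel :: "'a::euclidean_space set \<Rightarrow> 'a set set" where
  "relatively_compact_borel S =
     {A \<in> sets borel. \<exists>K. compact K \<and> K \<subseteq> S \<and> A \<subseteq> K}"

text \<open>Positive Radon measures on \<open>S\<close> are kept as Borel measures on the whole space carried by \<open>S\<close>.
  For the sets used below (open or closed), local finiteness already implies regularity.\<close>

definition radon_measure_on :: "'a::euclidean_space set \<Rightarrow> 'a measure \<Rightarrow> bool" where
  "radon_measure_on S P \<longleftrightarrow>
     sets P = sets borel \<and> emeasure P (- S) = 0 \<and>
     (\<forall>K. compact K \<and> K \<subseteq> S \<longrightarrow> emeasure P K < \<infinity>)"

text \<open>A signed Radon measure need not have a value on unbounded sets (or sets touching the boundary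
  of \<open>S\<close>), so it is a real set function whose values are meaningful on the relatively compact
  Borel subsets of \<open>S\<close> only; there it is a difference of two positive Radon measures.\<close>

definition represents_signed ::
    "'a::euclidean_space set \<Rightarrow> 'a measure \<Rightarrow> 'a measure \<Rightarrow> ('a set \<Rightarrow> real) \<Rightarrow> bool" where
  "represents_signed S P N \<nu> \<longleftrightarrow>
     radon_measure_on S P \<and> radon_measure_on S N \<and>
     (\<forall>A \<in> relatively_compact_borel S. \<nu> A = measure P A - measure N A)"

definition signed_radon_on :: "'a::euclidean_space set \<Rightarrow> ('a set \<Rightarrow> real) \<Rightarrow> bool" where
  "signed_radon_on S \<nu> \<longleftrightarrow> (\<exists>P N. represents_signed S P N \<nu>)"

text \<open>The value does not depend on the representing pair. Some pair integrates \<open>F\<close> iff the Jordan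
  decomposition does, that is, iff \<open>F\<close> is integrable for the total variation of \<open>\<nu>\<close>.\<close>

definition has_signed_integral ::
    "'a::euclidean_space set \<Rightarrow> ('a set \<Rightarrow> real) \<Rightarrow> ('a \<Rightarrow> real) \<Rightarrow> real \<Rightarrow> bool" where
  "has_signed_integral S \<nu> F I \<longleftrightarrow>
     (\<exists>P N. represents_signed S P N \<nu> \<and> integrable P F \<and> integrable N F \<and>
            I = integral\<^sup>L P F - integral\<^sup>L N F)"

definition signed_integral ::
    "'a::euclidean_space set \<Rightarrow> ('a set \<Rightarrow> real) \<Rightarrow> ('a \<Rightarrow> real) \<Rightarrow> real" where
  "signed_integral S \<nu> F = (THE I. has_signed_integral S \<nu> F I)"


section \<open>Distributional second derivatives\<close>

definition partial :: "'n::finite \<Rightarrow> (real^'n \<Rightarrow> real) \<Rightarrow> real^'n \<Rightarrow> real" where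
  "partial i f x = frechet_derivative f (at x) (axis i 1)"

fun C_k :: "nat \<Rightarrow> (real^'n::finite \<Rightarrow> real) \<Rightarrow> bool" where
  "C_k 0 f \<longleftrightarrow> continuous_on UNIV f"
| "C_k (Suc k) f \<longleftrightarrow> (\<forall>x. f differentiable at x) \<and> (\<forall>i. C_k k (partial i f))"

definition test_function :: "(real^'n::finite) set \<Rightarrow> (real^'n \<Rightarrow> real) \<Rightarrow> bool" where
  "test_function U \<phi> \<longleftrightarrow>
     (\<forall>k. C_k k \<phi>) \<and> compact (closure {x. \<phi> x \<noteq> 0}) \<and> closure {x. \<phi> x \<noteq> 0} \<subseteq> U"

definition is_distr_deriv2 ::
    "(real^'n::finite) set \<Rightarrow> (real^'n \<Rightarrow> real) \<Rightarrow> 'n \<Rightarrow> 'n \<Rightarrow> ((real^'n) set \<Rightarrow> real) \<Rightarrow> bool" where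
  "is_distr_deriv2 U f i j \<nu> \<longleftrightarrow>
     (\<forall>K. compact K \<and> K \<subseteq> U \<longrightarrow> set_integrable lborel K f) \<and>
     signed_radon_on U \<nu> \<and>
     (\<forall>\<phi>. test_function U \<phi> \<longrightarrow>
        has_signed_integral U \<nu> \<phi> (LINT x:U|lborel. f x * partial i (partial j \<phi>) x))"

text \<open>Unique on the relatively compact Borel subsets of \<open>U\<close>, if it exists as a signed Radon measure.\<close>

definition distr_deriv2 ::
    "(real^'n::finite) set \<Rightarrow> (real^'n \<Rightarrow> real) \<Rightarrow> 'n \<Rightarrow> 'n \<Rightarrow> (real^'n) set \<Rightarrow> real" where
  "distr_deriv2 U f i j = (SOME \<nu>. is_distr_deriv2 U f i j \<nu>)"


section \<open>The coefficients\<close>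

definition quadrant :: "(real^2) set" where
  "quadrant = {x. \<forall>i. 0 \<le> x $ i}"

definition open_quadrant :: "(real^2) set" where
  "open_quadrant = {x. \<forall>i. 0 < x $ i}"

definition diffusion_matrix :: "(real^2 \<Rightarrow> real^2^2) \<Rightarrow> real^2 \<Rightarrow> real^2^2" where
  "diffusion_matrix \<sigma> x = \<sigma> x ** transpose (\<sigma> x)"

text \<open>The library's notion is for time-dependent maps; the time variable is a dummy here.\<close>

definition locally_lipschitz_on ::
    "'a::metric_space set \<Rightarrow> ('a \<Rightarrow> 'b::metric_space) \<Rightarrow> bool" where
  "locally_lipschitz_on S f \<longleftrightarrow> local_lipschitz (UNIV :: real set) S (\<lambda>_. f)"

definition linear_growth_on ::
    "'a::real_normed_vector set \<Rightarrow> ('a \<Rightarrow> 'b::real_normed_vector) \<Rightarrow> bool" where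
  "linear_growth_on S f \<longleftrightarrow> (\<exists>C. \<forall>x\<in>S. norm (f x) \<le> C * (1 + norm x))"

definition locally_uniformly_elliptic_on ::
    "(real^'n::finite) set \<Rightarrow> (real^'n \<Rightarrow> real^'n^'n) \<Rightarrow> bool" where
  "locally_uniformly_elliptic_on U a \<longleftrightarrow>
     (\<forall>K. compact K \<and> K \<subseteq> U \<longrightarrow>
        (\<exists>m>0. \<forall>x\<in>K. \<forall>\<xi>. m * (norm \<xi>)\<^sup>2 \<le> \<xi> \<bullet> (a x *v \<xi>)))"


section \<open>Generator and stopping-gain measure\<close>

text \<open>The generator applied to \<open>f\<close> in the sense of distributions on the open quadrant, as a signed
  measure: pointwise (almost everywhere) first derivatives, and the product of the continuous
  \<open>a\<^sub>i\<^sub>j\<close> with the measure \<open>\<partial>\<^sub>i\<^sub>jf\<close>. It is extended by zero to the axes. At points where \<open>f\<close> is not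
  differentiable, \<open>partial i f\<close> has an unspecified value that does not depend on the point.\<close>

definition generator_measure ::
    "(real^2 \<Rightarrow> real^2) \<Rightarrow> (real^2 \<Rightarrow> real^2^2) \<Rightarrow> (real^2 \<Rightarrow> real) \<Rightarrow> (real^2) set \<Rightarrow> real" where
  "generator_measure \<mu> a f A =
     (LINT x:A \<inter> open_quadrant|lborel. \<Sum>i\<in>UNIV. \<mu> x $ i * partial i f x)
     + 1/2 * (\<Sum>i\<in>UNIV. \<Sum>j\<in>UNIV.
         signed_integral open_quadrant (distr_deriv2 open_quadrant f i j)
           (\<lambda>x. indicator (A \<inter> open_quadrant) x * a x $ i $ j))"

definition stopping_gain ::
    "(real^2 \<Rightarrow> real^2) \<Rightarrow> (real^2 \<Rightarrow> real^2^2) \<Rightarrow> (real^2 \<Rightarrow> real) \<Rightarrow> real \<Rightarrow> (real^2 \<Rightarrow> real)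
      \<Rightarrow> (real^2) set \<Rightarrow> real" where
  "stopping_gain \<mu> a c r f A =
     (LINT x:A \<inter> open_quadrant|lborel. c x + r * f x) - generator_measure \<mu> a f A"


section \<open>The payoff and the diagonal\<close>

definition payoff :: "real \<Rightarrow> real^2 \<Rightarrow> real" where
  "payoff \<alpha> x = max (x $ 1) (\<alpha> * x $ 2)"

definition diagonal :: "real \<Rightarrow> (real^2) set" where
  "diagonal \<alpha> = {x \<in> quadrant. x $ 1 = \<alpha> * x $ 2}"

definition diagonal_normal :: "real \<Rightarrow> real^2" where
  "diagonal_normal \<alpha> = vector [1, - \<alpha>]"

definition normal_form :: "real \<Rightarrow> (real^2 \<Rightarrow> real^2^2) \<Rightarrow> real^2 \<Rightarrow> real" where
  "normal_form \<alpha> a x = diagonal_normal \<alpha> \<bullet> (a x *v diagonal_normal \<alpha>)"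

text \<open>Arc-length measure \<open>ds = |\<gamma>'(t)| dt\<close> of an injective \<open>C\<^sup>1\<close> curve parametrised on \<open>I\<close>.\<close>

definition arc_length_measure :: "real set \<Rightarrow> (real \<Rightarrow> 'a::euclidean_space) \<Rightarrow> 'a measure" where
  "arc_length_measure I \<gamma> =
     distr (density lborel (\<lambda>t. ennreal (indicator I t * norm (vector_derivative \<gamma> (at t)))))
       borel \<gamma>"

definition diagonal_arc_length :: "real \<Rightarrow> (real^2) measure" where
  "diagonal_arc_length \<alpha> = arc_length_measure {0..} (\<lambda>t. vector [\<alpha> * t, t])"

text \<open>The value on the diagonal, a Lebesgue null set, is immaterial.\<close>

definition ac_density ::
    "real \<Rightarrow> (real^2 \<Rightarrow> real^2) \<Rightarrow> (real^2 \<Rightarrow> real) \<Rightarrow> real \<Rightarrow> real^2 \<Rightarrow> real" where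
  "ac_density \<alpha> \<mu> c r x =
     (if x $ 1 > \<alpha> * x $ 2 then c x + r * x $ 1 - \<mu> x $ 1
      else if x $ 1 < \<alpha> * x $ 2 then c x + r * \<alpha> * x $ 2 - \<alpha> * \<mu> x $ 2
      else 0)"

definition diagonal_part :: "real \<Rightarrow> (real^2 \<Rightarrow> real^2^2) \<Rightarrow> (real^2) set \<Rightarrow> real" where
  "diagonal_part \<alpha> a A =
     - (1 / (2 * sqrt (1 + \<alpha>\<^sup>2))) *
       (LINT x:A \<inter> diagonal \<alpha>|diagonal_arc_length \<alpha>. normal_form \<alpha> a x)"

end

theory Submission
  imports Defs
begin

text \<open>
  With \<open>n = (1, - \<alpha>)\<close> the payoff is \<open>\<alpha> x\<^sub>2 + (n \<bullet> x)\<^sup>+\<close>, so that \<open>\<partial>\<^sub>i\<^sub>j G = n\<^sub>i n\<^sub>j \<delta>(n \<bullet> x)\<close>, which is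
  \<open>n\<^sub>i n\<^sub>j / |n|\<close> times arc length on the diagonal; this is Fubini and the fundamental theorem of
  calculus on horizontal and vertical lines. Contracting with \<open>a/2\<close> gives the singular part, and the
  almost everywhere gradients \<open>(1, 0)\<close> and \<open>(0, \<alpha>)\<close> give the density. Since \<open>distr_deriv2\<close> is a choice,
  one needs that test functions determine a signed Radon measure: products of \<open>exp (- s / t)\<close> form
  test functions that converge to the indicator of a box as \<open>s\<close> tends to \<open>0\<close>.
\<close>

section \<open>Integration against signed Radon measures\<close>

text \<open>The positive and negative parts of a signed Radon measure may both be infinite on large
  sets, so differences cannot be compared there. Equality of two representations
  \<open>P - N\<close> and \<open>P' - N'\<close> is therefore always replaced by
  \<open>P + N' = P' + N\<close>, an identity of positive measures on all Borel sets; this is why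
  sums of measures are built up. A second obstacle is the boundary. The second derivatives live on
  the open quadrant, while the gain is evaluated on sets relatively compact in the closed quadrant,
  whose trace on the open one may reach the axes. The chosen derivative need not have a meaningful
  value on such a trace, but integrals against it do make sense: they are defined through
  representing pairs, which are tied to the values on relatively compact sets alone, and the
  diagonal has finite length near the origin. The square root is a change of measure: the
  distribution integrates \<open>dt\<close> along \<open>t -> (\<alpha> t, t)\<close>, whereas arc
  length is the speed times \<open>dt\<close>, and the tangent (\<alpha>, 1) has the same norm as
  the normal (1, -\<alpha>).\<close>

definition add_measure :: "'a measure \<Rightarrow> 'a measure \<Rightarrow> 'a measure" where
  "add_measure M N = measure_of (space M) (sets M) (\<lambda>A. emeasure M A + emeasure N A)"

lemma sets_add_measure [simp, measurable_cong]: "sets (add_measure M N) = sets M"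
  by (simp add: add_measure_def)

lemma space_add_measure [simp]: "space (add_measure M N) = space M"
  by (simp add: add_measure_def)

lemma emeasure_add_measure:
  assumes "sets M = sets N"
  shows "emeasure (add_measure M N) A = emeasure M A + emeasure N A"
proof (cases "A \<in> sets M")
  case True
  have "countably_additive (sets (add_measure M N)) (\<lambda>A. emeasure M A + emeasure N A)"
    unfolding countably_additive_def using assms
    by (auto simp: suminf_add[symmetric] suminf_emeasure)
  then show ?thesis
    using True by (intro emeasure_measure_of[OF add_measure_def sets.space_closed])
      (auto simp: positive_def)
qed (use assms in \<open>simp add: emeasure_notin_sets\<close>)

lemma nn_integral_add_measure:
  assumes [measurable_cong]: "sets N = sets M" and f: "f \<in> borel_measurable M"
  shows "(\<integral>\<^sup>+x. f x \<partial>add_measure M N) = (\<integral>\<^sup>+x. f x \<partial>M) + (\<integral>\<^sup>+x. f x \<partial>N)"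
  using f
proof induction
  case (cong f g)
  moreover have "space N = space M"
    using assms(1) by (rule sets_eq_imp_space_eq)
  ultimately show ?case
    by (simp cong: nn_integral_cong_simp)
next
  case (set A)
  then show ?case
    using assms by (simp add: emeasure_add_measure)
next
  case (mult u c)
  note [measurable] = \<open>u \<in> borel_measurable M\<close>
  show ?case
    using mult.IH by (simp add: nn_integral_cmult distrib_left)
next
  case (add u v)
  note [measurable] = \<open>u \<in> borel_measurable M\<close> \<open>v \<in> borel_measurable M\<close>
  show ?case
    using add.IH by (simp add: nn_integral_add ac_simps)
next
  case (seq U)
  note [measurable] = \<open>\<And>i. U i \<in> borel_measurable M\<close>
  \<comment> \<open>Stated for a general \<open>L\<close> because monotone convergence is needed for
    \<open>M\<close>, for \<open>N\<close> and for their sum.\<close>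
  have "(\<integral>\<^sup>+x. (SUP i. U i) x \<partial>L) = (SUP i. \<integral>\<^sup>+x. U i x \<partial>L)" if "sets L = sets M" for L
  proof -
    have [measurable]: "U i \<in> borel_measurable L" for i
      using seq(1)[of i] that by (simp cong: measurable_cong_sets)
    show ?thesis
      using seq(3) by (simp add: nn_integral_monotone_convergence_SUP Sup_fun_def image_comp)
  qed
  then show ?case
    using assms(1) seq(3) seq.IH
    by (simp add: ennreal_SUP_add[symmetric] incseq_def le_fun_def nn_integral_mono)
qed

lemma integrable_add_measure:
  fixes f :: "'a \<Rightarrow> real"
  assumes [measurable_cong]: "sets N = sets M"
    and int: "integrable M f" "integrable N f"
  shows "integrable (add_measure M N) f"
    and "integral\<^sup>L (add_measure M N) f = integral\<^sup>L M f + integral\<^sup>L N f"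
proof -
  have [measurable]: "f \<in> borel_measurable M"
    using int(1) by auto
  have [measurable]: "f \<in> borel_measurable (add_measure M N)"
    by simp
  have fin: "(\<integral>\<^sup>+x. ennreal (f x) \<partial>M) \<noteq> \<infinity>" "(\<integral>\<^sup>+x. ennreal (- f x) \<partial>M) \<noteq> \<infinity>"
    "(\<integral>\<^sup>+x. ennreal (f x) \<partial>N) \<noteq> \<infinity>" "(\<integral>\<^sup>+x. ennreal (- f x) \<partial>N) \<noteq> \<infinity>"
    using int by (auto simp: real_integrable_def)
  show "integrable (add_measure M N) f"
    using fin by (simp add: real_integrable_def nn_integral_add_measure assms)
  then show "integral\<^sup>L (add_measure M N) f = integral\<^sup>L M f + integral\<^sup>L N f"
    using int fin by (simp add: real_lebesgue_integral_def nn_integral_add_measure assms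
        enn2real_plus less_top)
qed

text \<open>Countable exhaustion by compact sets is what lets values on relatively compact sets
  determine a measure. Open and closed sets both have it, so one theory serves the open and the
  closed quadrant.\<close>

definition sigma_compact :: "'a::topological_space set \<Rightarrow> bool" where
  "sigma_compact S \<longleftrightarrow> (\<exists>K::nat \<Rightarrow> 'a set. (\<forall>n. compact (K n)) \<and> S = (\<Union>n. K n))"

lemma sigma_compact_open:
  fixes S :: "'a::euclidean_space set"
  assumes "open S"
  shows "sigma_compact S"
  unfolding sigma_compact_def by (rule open_Union_compact_subsets[OF assms]) auto

lemma sigma_compact_closed:
  fixes S :: "'a::euclidean_space set"
  assumes "closed S"
  shows "sigma_compact S"
  unfolding sigma_compact_def
proof (intro exI conjI allI)
  show "compact (S \<inter> cball 0 (real n))" for n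
    using assms by (simp add: closed_Int_compact)
  show "S = (\<Union>n. S \<inter> cball 0 (real n))"
    by (auto simp: real_arch_simple)
qed

lemma sigma_compact_borel:
  fixes S :: "'a::euclidean_space set"
  assumes "sigma_compact S"
  shows "S \<in> sets borel"
  using assms by (auto simp: sigma_compact_def borel_compact)

text \<open>Continuity from below along an exhaustion of \<open>S\<close>; the complement of
  \<open>S\<close> is null for both measures and may be removed beforehand.\<close>

lemma measure_eqI_relatively_compact:
  fixes M N :: "'a::euclidean_space measure"
  assumes S: "sigma_compact S"
    and sets: "sets M = sets borel" "sets N = sets borel"
    and null: "emeasure M (- S) = 0" "emeasure N (- S) = 0"
    and eq: "\<And>A. A \<in> relatively_compact_borel S \<Longrightarrow> emeasure M A = emeasure N A"
  shows "M = N"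
proof (rule measure_eqI)
  obtain K :: "nat \<Rightarrow> 'a set" where K: "\<And>n. compact (K n)" "S = (\<Union>n. K n)"
    using S by (auto simp: sigma_compact_def)
  \<comment> \<open>Finite unions turn the given compact cover into an increasing one.\<close>
  define L where "L n = (\<Union>i\<le>n. K i)" for n
  have L: "compact (L n)" "L n \<subseteq> S" for n
    using K by (auto simp: L_def)
  fix A assume A: "A \<in> sets M"
  have SB: "S \<in> sets borel"
    using S by (rule sigma_compact_borel)
  have lim: "emeasure R A = (SUP n. emeasure R (A \<inter> L n))"
    if R: "sets R = sets borel" "emeasure R (- S) = 0" for R
  proof -
    have "- S \<in> null_sets R"
      using R SB by (auto simp: null_sets_def)
    then have "emeasure R A = emeasure R (A - - S)"
      using A R sets by (intro emeasure_Diff_null_set[symmetric]) auto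
    also have "A - - S = (\<Union>n. A \<inter> L n)"
      using K by (auto simp: L_def)
    also have "emeasure R \<dots> = (SUP n. emeasure R (A \<inter> L n))"
    proof (rule SUP_emeasure_incseq[symmetric])
      show "range (\<lambda>n. A \<inter> L n) \<subseteq> sets R"
        using A R sets borel_compact[OF L(1)] by auto
      show "incseq (\<lambda>n. A \<inter> L n)"
        by (force simp: incseq_def L_def)
    qed
    finally show ?thesis .
  qed
  have "A \<inter> L n \<in> relatively_compact_borel S" for n
    using A L sets by (auto simp: relatively_compact_borel_def intro: borel_compact)
  then show "emeasure M A = emeasure N A"
    by (simp add: lim sets null eq)
qed (simp add: sets)

lemma radon_measure_on_relatively_compact:
  assumes "radon_measure_on S P" "A \<in> relatively_compact_borel S"
  shows "emeasure P A < \<infinity>"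
proof -
  obtain K where K: "compact K" "K \<subseteq> S" "A \<subseteq> K"
    using assms by (auto simp: relatively_compact_borel_def)
  then have "emeasure P A \<le> emeasure P K"
    using assms by (intro emeasure_mono) (auto simp: radon_measure_on_def intro: borel_compact)
  also have "\<dots> < \<infinity>"
    using assms K by (auto simp: radon_measure_on_def)
  finally show ?thesis .
qed

lemma radon_measure_on_add:
  assumes "radon_measure_on S P" "radon_measure_on S N"
  shows "radon_measure_on S (add_measure P N)"
  using assms by (auto simp: radon_measure_on_def emeasure_add_measure)

lemma represents_signed_cong:
  assumes "\<And>A. A \<in> relatively_compact_borel S \<Longrightarrow> \<nu> A = \<nu>' A"
  shows "represents_signed S P N \<nu> \<longleftrightarrow> represents_signed S P N \<nu>'"
  using assms by (auto simp: represents_signed_def)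

text \<open>Allows a derivative obtained by choice to be replaced by an explicit one although the
  two set functions may disagree on sets that are not relatively compact.\<close>

lemma has_signed_integral_cong:
  assumes "\<And>A. A \<in> relatively_compact_borel S \<Longrightarrow> \<nu> A = \<nu>' A"
  shows "has_signed_integral S \<nu> = has_signed_integral S \<nu>'"
  by (intro ext) (simp add: has_signed_integral_def represents_signed_cong[OF assms])

text \<open>On relatively compact sets all four values are finite, so the equality of the
  differences can be rearranged into one of sums; the sums then extend to all Borel sets, where a
  difference could read infinity minus infinity.\<close>

lemma represents_signed_add_eq:
  fixes P :: "'a::euclidean_space measure"
  assumes S: "sigma_compact S"
    and 1: "represents_signed S P N \<nu>" and 2: "represents_signed S P' N' \<nu>"
  shows "add_measure P N' = add_measure P' N"
proof (rule measure_eqI_relatively_compact[OF S])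
  have r: "radon_measure_on S P" "radon_measure_on S N"
    "radon_measure_on S P'" "radon_measure_on S N'"
    using 1 2 by (auto simp: represents_signed_def)
  then have s: "sets P = sets borel" "sets N = sets borel" "sets P' = sets borel"
    "sets N' = sets borel"
    by (auto simp: radon_measure_on_def)
  show "sets (add_measure P N') = sets borel" "sets (add_measure P' N) = sets borel"
    by (simp_all add: s)
  show "emeasure (add_measure P N') (- S) = 0" "emeasure (add_measure P' N) (- S) = 0"
    using r by (simp_all add: s emeasure_add_measure radon_measure_on_def)
  fix A assume A: "A \<in> relatively_compact_borel S"
  have fin: "emeasure P A = ennreal (measure P A)" "emeasure N A = ennreal (measure N A)"
    "emeasure P' A = ennreal (measure P' A)" "emeasure N' A = ennreal (measure N' A)"
    using radon_measure_on_relatively_compact[OF _ A] r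
    by (simp_all add: emeasure_eq_ennreal_measure less_top)
  have "\<nu> A = measure P A - measure N A" "\<nu> A = measure P' A - measure N' A"
    using 1 2 A unfolding represents_signed_def by blast+
  then have "measure P A + measure N' A = measure P' A + measure N A"
    by linarith
  then show "emeasure (add_measure P N') A = emeasure (add_measure P' N) A"
    by (simp add: s emeasure_add_measure fin flip: ennreal_plus)
qed

text \<open>Integrating \<open>F\<close> against the common measure \<open>P + N' = P' + N\<close>
  and rearranging; this justifies the definite description in
  \<open>signed_integral\<close>.\<close>

lemma has_signed_integral_unique:
  fixes S :: "'a::euclidean_space set"
  assumes S: "sigma_compact S"
    and "has_signed_integral S \<nu> F I" "has_signed_integral S \<nu> F J"
  shows "I = J"
proof -
  obtain P N P' N' where r: "represents_signed S P N \<nu>" "represents_signed S P' N' \<nu>"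
    and int: "integrable P F" "integrable N F" "integrable P' F" "integrable N' F"
    and I: "I = integral\<^sup>L P F - integral\<^sup>L N F" and J: "J = integral\<^sup>L P' F - integral\<^sup>L N' F"
    using assms by (auto simp: has_signed_integral_def)
  have s: "sets P = sets borel" "sets N = sets borel" "sets P' = sets borel"
    "sets N' = sets borel"
    using r by (auto simp: represents_signed_def radon_measure_on_def)
  have "integral\<^sup>L (add_measure P N') F = integral\<^sup>L (add_measure P' N) F"
    by (simp add: represents_signed_add_eq[OF S r])
  then show ?thesis
    using int I J by (simp add: integrable_add_measure s)
qed

lemma signed_integral_eqI:
  assumes "sigma_compact S" "has_signed_integral S \<nu> F I"
  shows "signed_integral S \<nu> F = I"
  unfolding signed_integral_def using assms by (blast intro: has_signed_integral_unique)

lemma signed_radon_on_add: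
  fixes S :: "'a::euclidean_space set"
  assumes "signed_radon_on S \<nu>" "signed_radon_on S \<nu>'"
    and "\<And>A. A \<in> relatively_compact_borel S \<Longrightarrow> \<rho> A = \<nu> A + \<nu>' A"
  shows "signed_radon_on S \<rho>"
proof -
  obtain P N P' N' where r: "represents_signed S P N \<nu>" "represents_signed S P' N' \<nu>'"
    using assms by (auto simp: signed_radon_on_def)
  then have R: "radon_measure_on S P" "radon_measure_on S N"
    "radon_measure_on S P'" "radon_measure_on S N'"
    by (auto simp: represents_signed_def)
  then have s: "sets P = sets borel" "sets N = sets borel" "sets P' = sets borel"
    "sets N' = sets borel"
    by (auto simp: radon_measure_on_def)
  \<comment> \<open>Real-valued \<open>measure\<close> is additive here because both extended values
    are finite on relatively compact sets.\<close>
  have meas: "measure (add_measure Q Q') A = measure Q A + measure Q' A"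
    if "radon_measure_on S Q" "radon_measure_on S Q'" "A \<in> relatively_compact_borel S" for Q Q' A
    using that radon_measure_on_relatively_compact[of S _ A]
    by (simp add: measure_def emeasure_add_measure radon_measure_on_def enn2real_plus)
  have "represents_signed S (add_measure P P') (add_measure N N') \<rho>"
    unfolding represents_signed_def
    using R r assms(3) by (auto simp: radon_measure_on_add meas represents_signed_def)
  then show ?thesis
    by (auto simp: signed_radon_on_def)
qed

lemma relatively_compact_borel_set_integrable:
  fixes h :: "'a::euclidean_space \<Rightarrow> real"
  assumes "A \<in> relatively_compact_borel S" "sets M = sets borel"
    and "\<And>K. compact K \<Longrightarrow> K \<subseteq> S \<Longrightarrow> set_integrable M K h"
  shows "set_integrable M A h"
proof -
  obtain K where K: "compact K" "K \<subseteq> S" "A \<subseteq> K" "A \<in> sets borel"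
    using assms(1) by (auto simp: relatively_compact_borel_def)
  then show ?thesis
    using assms(2) by (intro set_integrable_subset[OF assms(3)[of K]]) auto
qed

section \<open>Signed measures given by a locally integrable density\<close>

context
  fixes S :: "'a::euclidean_space set" and M :: "'a measure" and h :: "'a \<Rightarrow> real"
  assumes S: "sigma_compact S" and sets_M: "sets M = sets borel"
    and h_meas: "(\<lambda>x. indicator S x * h x) \<in> borel_measurable borel"
    and h_int: "\<And>K. compact K \<Longrightarrow> K \<subseteq> S \<Longrightarrow> set_integrable M K h"
begin

text \<open>The two halves of the Jordan decomposition. The cut-off by \<open>S\<close> is
  essential, since nothing is known about \<open>h\<close> outside \<open>S\<close>; the
  coefficients are controlled on the quadrant only.\<close>

qualified definition pos where "pos = density M (\<lambda>x. ennreal (max 0 (indicator S x * h x)))"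
qualified definition neg where "neg = density M (\<lambda>x. ennreal (max 0 (- (indicator S x * h x))))"

lemma h_meas_M [measurable]: "(\<lambda>x. indicator S x * h x) \<in> borel_measurable M"
  using h_meas sets_M by (simp cong: measurable_cong_sets)

lemma represents_signed_density: "represents_signed S pos neg (\<lambda>A. LINT x:A|M. h x)"
proof -
  note [measurable] = h_meas_M
  have SB: "S \<in> sets M"
    using S sets_M by (simp add: sigma_compact_borel)
  have null: "emeasure pos (- S) = 0" "emeasure neg (- S) = 0"
    using SB sets_M
    by (auto simp: pos_def neg_def emeasure_density nn_integral_0_iff_AE split: split_indicator)
  \<comment> \<open>\<open>ennreal\<close> sends negative reals to 0, so it takes the positive part
    by itself.\<close>
  have em: "emeasure pos A = (\<integral>\<^sup>+x. ennreal (indicator A x * h x) \<partial>M)"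
           "emeasure neg A = (\<integral>\<^sup>+x. ennreal (- (indicator A x * h x)) \<partial>M)"
    if "A \<in> sets M" "A \<subseteq> S" for A
    using that unfolding pos_def neg_def
    by (auto simp: emeasure_density max_def intro!: nn_integral_cong ennreal_neg
        split: split_indicator)
  have fin: "emeasure pos K < \<infinity>" "emeasure neg K < \<infinity>" if "compact K" "K \<subseteq> S" for K
    using h_int[OF that] that sets_M em[of K]
    by (auto simp: set_integrable_def real_integrable_def borel_compact less_top)
  have "(LINT x:A|M. h x) = measure pos A - measure neg A"
    if A: "A \<in> relatively_compact_borel S" for A
  proof -
    have "set_integrable M A h"
      using A sets_M h_int by (rule relatively_compact_borel_set_integrable)
    moreover have "A \<in> sets M" "A \<subseteq> S"
      using A sets_M by (auto simp: relatively_compact_borel_def)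
    ultimately show ?thesis
      by (simp add: set_integrable_def set_lebesgue_integral_def measure_def em
          real_lebesgue_integral_def)
  qed
  then show ?thesis
    using null fin by (auto simp: represents_signed_def radon_measure_on_def)
      (auto simp: pos_def neg_def sets_M)
qed

lemma has_signed_integral_density:
  assumes [measurable]: "F \<in> borel_measurable borel" and int: "set_integrable M S (\<lambda>x. h x * F x)"
  shows "has_signed_integral S (\<lambda>A. LINT x:A|M. h x) F (LINT x:S|M. h x * F x)"
proof -
  note [measurable] = h_meas_M
  have [measurable]: "F \<in> borel_measurable M"
    using sets_M by (simp cong: measurable_cong_sets)
  let ?p = "\<lambda>x. max 0 (indicator S x * h x)" and ?n = "\<lambda>x. max 0 (- (indicator S x * h x))"
  have i: "integrable M (\<lambda>x. indicator S x * (h x * F x))"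
    using int by (simp add: set_integrable_def)
  have ip: "integrable M (\<lambda>x. ?p x * F x)" and "in": "integrable M (\<lambda>x. ?n x * F x)"
    using i by (rule Bochner_Integration.integrable_bound;
        auto simp: max_def abs_mult split: split_indicator)+
  have "integral\<^sup>L pos F - integral\<^sup>L neg F = (\<integral>x. ?p x * F x - ?n x * F x \<partial>M)"
    using ip "in" by (simp add: pos_def neg_def integral_density)
  also have "(\<lambda>x. ?p x * F x - ?n x * F x) = (\<lambda>x. indicator S x * (h x * F x))"
    by (auto simp: max_def split: split_indicator)
  finally have "(LINT x:S|M. h x * F x) = integral\<^sup>L pos F - integral\<^sup>L neg F"
    by (simp add: set_lebesgue_integral_def)
  moreover have "integrable pos F" "integrable neg F"
    using ip "in" by (simp_all add: pos_def neg_def integrable_density)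
  ultimately show ?thesis
    unfolding has_signed_integral_def using represents_signed_density by blast
qed

text \<open>Minimality of the Jordan decomposition: \<open>pos\<close> is dominated by
  \<open>P\<close> and \<open>neg\<close> by \<open>N\<close> for every representing pair, so
  integrability against any pair carries over to the density.\<close>

lemma has_signed_integral_density_integrable:
  assumes "has_signed_integral S (\<lambda>A. LINT x:A|M. h x) F I"
  shows "set_integrable M S (\<lambda>x. h x * F x)"
proof -
  note [measurable] = h_meas_M
  obtain P N where r: "represents_signed S P N (\<lambda>A. LINT x:A|M. h x)"
    and int: "integrable P F" "integrable N F"
    using assms by (auto simp: has_signed_integral_def)
  have s [measurable_cong]: "sets P = sets borel" "sets N = sets borel" "sets M = sets borel"
    "sets pos = sets borel" "sets neg = sets borel"
    using r by (auto simp: represents_signed_def radon_measure_on_def pos_def neg_def sets_M)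
  have [measurable]: "F \<in> borel_measurable borel"
    using int(1) s(1) by (metis borel_measurable_integrable measurable_cong_sets)
  have eq: "add_measure P neg = add_measure pos N"
    using represents_signed_add_eq[OF S r represents_signed_density] .
  let ?h = "\<lambda>x. indicator S x * h x"
  \<comment> \<open>In this form, with sums of nonnegative integrals, the identity holds even when
    some of them are infinite.\<close>
  have add: "(\<integral>\<^sup>+x. g x \<partial>P) + (\<integral>\<^sup>+x. g x \<partial>neg) = (\<integral>\<^sup>+x. g x \<partial>pos) + (\<integral>\<^sup>+x. g x \<partial>N)"
    if [measurable]: "g \<in> borel_measurable borel" for g
    using arg_cong[OF eq, of "\<lambda>L. \<integral>\<^sup>+x. g x \<partial>L"] by (simp add: nn_integral_add_measure s)
  \<comment> \<open>the densities of \<open>pos\<close> and \<open>neg\<close> have disjoint supports, so a cut-off removes the other one\<close>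
  have le_pos: "(\<integral>\<^sup>+x. ennreal \<bar>F x\<bar> \<partial>pos) \<le> (\<integral>\<^sup>+x. ennreal \<bar>F x\<bar> \<partial>P)"
  proof -
    let ?g = "\<lambda>x. ennreal \<bar>F x\<bar> * indicator {x. ?h x > 0} x"
    have [measurable]: "{x. ?h x > 0} \<in> sets borel"
      using h_meas by measurable
    have "(\<integral>\<^sup>+x. ennreal \<bar>F x\<bar> \<partial>pos) = (\<integral>\<^sup>+x. ?g x \<partial>pos)"
      by (auto simp: pos_def nn_integral_density max_def intro!: nn_integral_cong
          split: split_indicator)
    also have "\<dots> \<le> (\<integral>\<^sup>+x. ?g x \<partial>pos) + (\<integral>\<^sup>+x. ?g x \<partial>N)"
      by simp
    also have "\<dots> = (\<integral>\<^sup>+x. ?g x \<partial>P) + (\<integral>\<^sup>+x. ?g x \<partial>neg)"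
      by (simp add: add)
    also have "(\<integral>\<^sup>+x. ?g x \<partial>neg) = 0"
      by (auto simp: neg_def nn_integral_density nn_integral_0_iff_AE max_def
          split: split_indicator)
    also have "(\<integral>\<^sup>+x. ?g x \<partial>P) + 0 \<le> (\<integral>\<^sup>+x. ennreal \<bar>F x\<bar> \<partial>P)"
      by (auto intro!: nn_integral_mono split: split_indicator)
    finally show ?thesis .
  qed
  have le_neg: "(\<integral>\<^sup>+x. ennreal \<bar>F x\<bar> \<partial>neg) \<le> (\<integral>\<^sup>+x. ennreal \<bar>F x\<bar> \<partial>N)"
  proof -
    let ?g = "\<lambda>x. ennreal \<bar>F x\<bar> * indicator {x. ?h x < 0} x"
    have [measurable]: "{x. ?h x < 0} \<in> sets borel"
      using h_meas by measurable
    have "(\<integral>\<^sup>+x. ennreal \<bar>F x\<bar> \<partial>neg) = (\<integral>\<^sup>+x. ?g x \<partial>neg)"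
      by (auto simp: neg_def nn_integral_density max_def intro!: nn_integral_cong
          split: split_indicator)
    also have "\<dots> \<le> (\<integral>\<^sup>+x. ?g x \<partial>P) + (\<integral>\<^sup>+x. ?g x \<partial>neg)"
      by simp
    also have "\<dots> = (\<integral>\<^sup>+x. ?g x \<partial>pos) + (\<integral>\<^sup>+x. ?g x \<partial>N)"
      by (simp add: add)
    also have "(\<integral>\<^sup>+x. ?g x \<partial>pos) = 0"
      by (auto simp: pos_def nn_integral_density nn_integral_0_iff_AE max_def
          split: split_indicator)
    also have "0 + (\<integral>\<^sup>+x. ?g x \<partial>N) \<le> (\<integral>\<^sup>+x. ennreal \<bar>F x\<bar> \<partial>N)"
      by (auto intro!: nn_integral_mono split: split_indicator)
    finally show ?thesis .
  qed
  have "integrable pos F" "integrable neg F"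
    using le_pos le_neg int by (auto simp: integrable_iff_bounded)
  then have "integrable M (\<lambda>x. max 0 (?h x) * F x - max 0 (- ?h x) * F x)"
    by (simp add: pos_def neg_def integrable_density)
  also have "(\<lambda>x. max 0 (?h x) * F x - max 0 (- ?h x) * F x) = (\<lambda>x. indicator S x * (h x * F x))"
    by (auto simp: max_def split: split_indicator)
  finally show ?thesis
    by (simp add: set_integrable_def)
qed

lemma has_signed_integral_density_iff:
  assumes "F \<in> borel_measurable borel"
  shows "has_signed_integral S (\<lambda>A. LINT x:A|M. h x) F I \<longleftrightarrow>
    set_integrable M S (\<lambda>x. h x * F x) \<and> I = (LINT x:S|M. h x * F x)"
  using has_signed_integral_density[OF assms] has_signed_integral_density_integrable
    has_signed_integral_unique[OF S] by blast

lemma signed_radon_on_density: "signed_radon_on S (\<lambda>A. LINT x:A|M. h x)"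
  using represents_signed_density by (auto simp: signed_radon_on_def)

end

section \<open>Test functions determine a Radon measure\<close>

text \<open>For \<open>m = 0\<close> this is the classical smooth function that is flat at 0. The
  powers of \<open>t\<close> in the denominator make the family closed under differentiation up to
  linear combinations; \<open>s\<close> is kept as the parameter of the later limit.\<close>

definition flat :: "real \<Rightarrow> nat \<Rightarrow> real \<Rightarrow> real" where
  "flat s m t = (if t > 0 then exp (- s / t) / t ^ m else 0)"

text \<open>With \<open>u = s / t\<close> the right branch is \<open>u ^ m / exp u / s ^ m\<close>,
  and the exponential beats every power as \<open>u\<close> tends to infinity.\<close>

lemma tendsto_flat_0:
  assumes "s > 0"
  shows "(flat s m \<longlongrightarrow> 0) (at 0)"
proof (rule filterlim_split_at)
  show "(flat s m \<longlongrightarrow> 0) (at_left 0)"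
    by (rule tendsto_eventually) (auto simp: flat_def eventually_at_filter)
  have "filterlim (\<lambda>t. s / t) at_top (at_right 0)"
    using assms filterlim_tendsto_pos_mult_at_top[OF tendsto_const[of s] assms
        filterlim_inverse_at_top_right] by (simp add: divide_inverse)
  then have "((\<lambda>t. (s / t) ^ m / exp (s / t) / s ^ m) \<longlongrightarrow> 0 / s ^ m) (at_right 0)"
    using assms by (intro tendsto_divide filterlim_compose[OF tendsto_power_div_exp_0]) auto
  moreover have "eventually (\<lambda>t. (s / t) ^ m / exp (s / t) / s ^ m = flat s m t) (at_right 0)"
    using eventually_at_right_less[of 0]
    by eventually_elim (use assms in \<open>simp add: flat_def exp_minus power_divide field_simps\<close>)
  ultimately show "(flat s m \<longlongrightarrow> 0) (at_right 0)"
    by (auto elim: Lim_transform_eventually)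
qed

lemma has_real_derivative_flat:
  assumes "s > 0"
  shows "(flat s m has_real_derivative s * flat s (m + 2) t - real m * flat s (m + 1) t) (at t)"
proof (cases t "0::real" rule: linorder_cases)
  case less
  have "(flat s m has_real_derivative 0) (at t)"
    by (rule has_field_derivative_transform_within_open[OF DERIV_const, where S = "{..<0}"])
      (use less in \<open>auto simp: flat_def\<close>)
  then show ?thesis
    using less by (simp add: flat_def)
next
  case equal
  \<comment> \<open>The difference quotient of \<open>flat s m\<close> at 0 is
    \<open>flat s (Suc m)\<close>, which tends to 0.\<close>
  have "((\<lambda>h. (flat s m (0 + h) - flat s m 0) / h) \<longlongrightarrow> 0) (at 0)"
    using tendsto_flat_0[OF assms, of "Suc m"]
    by (rule Lim_transform_eventually)
      (auto simp: flat_def eventually_at_filter field_simps intro!: always_eventually)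
  then show ?thesis
    using equal by (simp add: DERIV_def flat_def)
next
  case greater
  have "((\<lambda>t. exp (- s / t) / t ^ m) has_real_derivative
      s * (exp (- s / t) / t ^ (m + 2)) - real m * (exp (- s / t) / t ^ (m + 1))) (at t)"
    using greater
    by (auto intro!: derivative_eq_intros simp: field_simps power2_eq_square)
      (cases m; simp add: field_simps)
  then have "(flat s m has_real_derivative
      s * (exp (- s / t) / t ^ (m + 2)) - real m * (exp (- s / t) / t ^ (m + 1))) (at t)"
    by (rule has_field_derivative_transform_within_open[where S = "{0<..}"])
      (use greater in \<open>auto simp: flat_def\<close>)
  then show ?thesis
    using greater by (simp add: flat_def)
qed

section \<open>Partial derivatives and a class of smooth functions\<close>

lemma partial_eqI:
  assumes "(f has_derivative f') (at x)"
  shows "partial i f x = f' (axis i 1)"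
  using frechet_derivative_at[OF assms] by (simp add: partial_def)

lemma has_derivative_partial:
  assumes "f differentiable (at x)"
  shows "(f has_derivative frechet_derivative f (at x)) (at x)"
  using assms by (simp add: frechet_derivative_works)

lemma partial_add:
  assumes "f differentiable (at x)" "g differentiable (at x)"
  shows "partial i (\<lambda>x. f x + g x) x = partial i f x + partial i g x"
  unfolding partial_def[of i f] partial_def[of i g]
  by (rule partial_eqI[OF has_derivative_add[OF assms[THEN has_derivative_partial]]])

lemma partial_mult:
  assumes "f differentiable (at x)" "g differentiable (at x)"
  shows "partial i (\<lambda>x. f x * g x) x = f x * partial i g x + partial i f x * g x"
  unfolding partial_def[of i f] partial_def[of i g]
  by (rule partial_eqI[OF has_derivative_mult[OF assms[THEN has_derivative_partial]]])

text \<open>A class that contains the bumps and is stable under every partial derivative, so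
  smoothness of all orders follows by induction without computing a higher derivative. The affine
  argument admits both \<open>x $ i - a $ i\<close> and \<open>b $ i - x $ i\<close>.\<close>

inductive bump_algebra :: "(real^'n::finite \<Rightarrow> real) \<Rightarrow> bool" where
  flat: "s > 0 \<Longrightarrow> bump_algebra (\<lambda>x. flat s m (c * x $ i + d))"
| const: "bump_algebra (\<lambda>x. c)"
| add: "bump_algebra f \<Longrightarrow> bump_algebra g \<Longrightarrow> bump_algebra (\<lambda>x. f x + g x)"
| mult: "bump_algebra f \<Longrightarrow> bump_algebra g \<Longrightarrow> bump_algebra (\<lambda>x. f x * g x)"

lemma bump_algebra_prod:
  fixes f :: "'i \<Rightarrow> real^'n::finite \<Rightarrow> real"
  assumes "\<And>i. i \<in> I \<Longrightarrow> bump_algebra (f i)"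
  shows "bump_algebra (\<lambda>x. \<Prod>i\<in>I. f i x)"
  using assms
  by (induction I rule: infinite_finite_induct) (auto intro: bump_algebra.intros)

lemma bump_algebra_partial:
  fixes f :: "real^'n::finite \<Rightarrow> real"
  assumes "bump_algebra f"
  shows "(\<forall>x. f differentiable (at x)) \<and> (\<forall>j. bump_algebra (partial j f))"
  using assms
proof induction
  case (flat s m c i d)
  let ?f' = "\<lambda>t. s * flat s (m + 2) t - real m * flat s (m + 1) t"
  have D: "((\<lambda>x. flat s m (c * x $ i + d)) has_derivative
      (\<lambda>h. ?f' (c * x $ i + d) * (c * h $ i))) (at x)" for x :: "real^'n"
    by (rule has_derivative_compose[where g = "flat s m" and f = "\<lambda>x. c * x $ i + d"
          and g' = "\<lambda>y. ?f' (c * x $ i + d) * y"])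
      (use has_real_derivative_flat[OF flat, of m "c * x $ i + d"]
        in \<open>auto simp: has_field_derivative_def intro!: derivative_eq_intros
            bounded_linear_imp_has_derivative bounded_linear_vec_nth\<close>)
  have "partial j (\<lambda>x. flat s m (c * x $ i + d)) =
      (\<lambda>x. (s * (c * axis j 1 $ i)) * flat s (m + 2) (c * x $ i + d)
        + (- real m * (c * axis j 1 $ i)) * flat s (m + 1) (c * x $ i + d))" for j
    using partial_eqI[OF D] by (auto simp: fun_eq_iff algebra_simps)
  then have "bump_algebra (partial j (\<lambda>x. flat s m (c * x $ i + d)))" for j
    by (simp only:) (intro bump_algebra.intros flat)
  then show ?case
    using D by (auto simp: differentiable_def)
next
  case (const c)
  have "partial j (\<lambda>x. c) = (\<lambda>x :: real^'n. 0)" for j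
    by (auto intro!: partial_eqI)
  then show ?case
    by (auto intro: bump_algebra.intros)
next
  case (add f g)
  have "partial j (\<lambda>x. f x + g x) = (\<lambda>x. partial j f x + partial j g x)" for j
    using add.IH by (auto intro!: partial_add)
  then show ?case
    using add.IH by (simp add: bump_algebra.add)
next
  case (mult f g)
  have "partial j (\<lambda>x. f x * g x) = (\<lambda>x. f x * partial j g x + partial j f x * g x)" for j
    using mult.IH by (auto intro!: partial_mult)
  then show ?case
    using mult by (simp add: bump_algebra.add bump_algebra.mult)
qed

lemma bump_algebra_C_k: "bump_algebra f \<Longrightarrow> C_k k f"
proof (induction k arbitrary: f)
  case 0
  then show ?case
    using bump_algebra_partial[OF 0]
    by (auto intro!: continuous_at_imp_continuous_on differentiable_imp_continuous_within)
qed (simp add: bump_algebra_partial)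

text \<open>One pair of flat factors per coordinate, one for each face of the box: the product is
  positive exactly inside the open box.\<close>

definition bump :: "real \<Rightarrow> real^'n::finite \<Rightarrow> real^'n \<Rightarrow> real^'n \<Rightarrow> real" where
  "bump s a b x = (\<Prod>i\<in>UNIV. flat s 0 (x $ i - a $ i) * flat s 0 (b $ i - x $ i))"

lemma bump_eq_0_iff: "bump s a b x = 0 \<longleftrightarrow> x \<notin> box a b"
  by (auto simp: bump_def flat_def mem_box_cart)

lemma bump_bounds:
  assumes "s > 0"
  shows "0 \<le> bump s a b x" "bump s a b x \<le> indicator (box a b) x"
proof -
  have f: "0 \<le> flat s 0 t \<and> flat s 0 t \<le> 1" for t
    using assms by (auto simp: flat_def)
  show "0 \<le> bump s a b x"
    using f by (auto simp: bump_def intro!: prod_nonneg)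
  have "bump s a b x \<le> 1"
    using f unfolding bump_def by (intro prod_le_1) (auto intro!: mult_le_one)
  then show "bump s a b x \<le> indicator (box a b) x"
    using bump_eq_0_iff[of s a b x] by (auto split: split_indicator)
qed

lemma tendsto_bump: "(\<lambda>n. bump (1 / real (Suc n)) a b x) \<longlonglongrightarrow> indicator (box a b) x"
proof (cases "x \<in> box a b")
  case True
  have "(\<lambda>n. exp (- (1 / real (Suc n)) / t)) \<longlonglongrightarrow> exp (- 0 / t)" if "t > 0" for t
    using that by (intro tendsto_intros LIMSEQ_Suc lim_1_over_n) auto
  then have "(\<lambda>n. flat (1 / real (Suc n)) 0 t) \<longlonglongrightarrow> 1" if "t > 0" for t
    using that by (simp add: flat_def)
  then have "(\<lambda>n. bump (1 / real (Suc n)) a b x) \<longlonglongrightarrow> (\<Prod>i\<in>(UNIV::'a set). 1 * 1)"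
    using True unfolding bump_def by (intro tendsto_intros) (auto simp: mem_box_cart)
  then show ?thesis
    using True by simp
next
  case False
  then have "bump s a b x = 0" for s
    by (simp add: bump_eq_0_iff)
  then show ?thesis
    using False by simp
qed

text \<open>The closed box has to lie in \<open>U\<close> because the support of the bump is a
  closure.\<close>

lemma test_function_bump:
  assumes "s > 0" "cbox a b \<subseteq> U"
  shows "test_function U (bump s a b)"
proof -
  have "bump_algebra (\<lambda>x. flat s 0 (1 * x $ i + - a $ i) * flat s 0 (- 1 * x $ i + b $ i))" for i
    using assms by (intro bump_algebra.intros)
  then have "bump_algebra (bump s a b)"
    unfolding bump_def by (intro bump_algebra_prod) (simp add: bump_def)
  moreover have cl: "closure {x. bump s a b x \<noteq> 0} \<subseteq> cbox a b"
    using box_subset_cbox[of a b] by (intro closure_minimal) (auto simp: bump_eq_0_iff)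
  then have "compact (closure {x. bump s a b x \<noteq> 0})"
    by (meson bounded_cbox bounded_subset closed_closure compact_eq_bounded_closed)
  ultimately show ?thesis
    using assms cl by (auto simp: test_function_def bump_algebra_C_k)
qed

section \<open>Radon measures tested against smooth functions\<close>

lemma test_function_continuous:
  assumes "test_function U \<phi>"
  shows "continuous_on UNIV \<phi>"
  using assms C_k.simps(1) unfolding test_function_def by blast

lemma integrable_test_function:
  fixes \<phi> :: "real^'n::finite \<Rightarrow> real"
  assumes \<phi>: "test_function U \<phi>" and M: "radon_measure_on U M"
  shows "integrable M \<phi>"
proof -
  let ?K = "closure {x. \<phi> x \<noteq> 0}"
  have K: "compact ?K" "?K \<subseteq> U"
    using \<phi> by (auto simp: test_function_def)
  have sets: "sets M = sets borel"
    using M by (simp add: radon_measure_on_def)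
  have c: "continuous_on UNIV \<phi>"
    using \<phi> by (rule test_function_continuous)
  have "compact (\<phi> ` ?K)"
    using K c by (blast intro: compact_continuous_image continuous_on_subset)
  then obtain B where B: "\<forall>x\<in>?K. \<bar>\<phi> x\<bar> \<le> B"
    by (auto dest!: compact_imp_bounded simp: bounded_iff)
  show ?thesis
  proof (rule Bochner_Integration.integrable_bound)
    show "integrable M (\<lambda>x. B * indicator ?K x)"
      using K M sets by (auto simp: radon_measure_on_def borel_compact)
    show "\<phi> \<in> borel_measurable M"
      using c sets borel_measurable_continuous_onI by (simp cong: measurable_cong_sets)
    have "norm (\<phi> x) \<le> norm (B * indicator ?K x)" for x
    proof (cases "\<phi> x = 0")
      case False
      then have "x \<in> ?K"
        using closure_subset by fastforce
      then show ?thesis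
        using bspec[OF B, of x] by simp
    qed simp
    then show "AE x in M. norm (\<phi> x) \<le> norm (B * indicator ?K x)"
      by simp
  qed
qed

text \<open>Boxes whose closure lies in \<open>U\<close> are reached by dominated convergence of
  bumps; Borel subsets of one such box by uniqueness on an intersection-stable generator; a
  relatively compact set by covering it with finitely many such boxes.\<close>

lemma radon_measure_eqI_test_function:
  fixes M N :: "(real^'n::finite) measure"
  assumes U: "open U" and M: "radon_measure_on U M" and N: "radon_measure_on U N"
    and eq: "\<And>\<phi>. test_function U \<phi> \<Longrightarrow> integral\<^sup>L M \<phi> = integral\<^sup>L N \<phi>"
  shows "M = N"
proof (rule measure_eqI_relatively_compact[OF sigma_compact_open[OF U]])
  show sets: "sets M = sets borel" "sets N = sets borel"
    and "emeasure M (- U) = 0" "emeasure N (- U) = 0"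
    using M N by (auto simp: radon_measure_on_def)
  have fin: "emeasure L (box a b) < \<infinity>"
    if "radon_measure_on U L" "cbox a b \<subseteq> U" for L and a b :: "real^'n"
  proof -
    have "emeasure L (box a b) \<le> emeasure L (cbox a b)"
      using that by (intro emeasure_mono box_subset_cbox) (auto simp: radon_measure_on_def)
    then show ?thesis
      using that compact_cbox[of a b] by (auto simp: radon_measure_on_def intro: le_less_trans)
  qed
  have box: "emeasure M (box a b) = emeasure N (box a b)" if "cbox a b \<subseteq> U" for a b
  proof -
    have lim: "(\<lambda>n. integral\<^sup>L L (bump (1 / real (Suc n)) a b)) \<longlonglongrightarrow> measure L (box a b)"
      if L: "radon_measure_on U L" for L
    proof -
      have s: "sets L = sets borel"
        using L by (simp add: radon_measure_on_def)
      have "(\<lambda>n. integral\<^sup>L L (bump (1 / real (Suc n)) a b))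
          \<longlonglongrightarrow> integral\<^sup>L L (\<lambda>x. indicator (box a b) x :: real)"
      proof (rule integral_dominated_convergence[where w = "indicator (box a b)"])
        show "integrable L (indicator (box a b) :: _ \<Rightarrow> real)"
          using fin[OF L \<open>cbox a b \<subseteq> U\<close>] s by simp
        show "bump (1 / real (Suc n)) a b \<in> borel_measurable L" for n
          using integrable_test_function[OF test_function_bump[OF _ \<open>cbox a b \<subseteq> U\<close>] L] by auto
        show "AE x in L. norm (bump (1 / real (Suc n)) a b x) \<le> indicator (box a b) x" for n
          using bump_bounds[of "1 / real (Suc n)" a b] by simp
        show "AE x in L. (\<lambda>n. bump (1 / real (Suc n)) a b x) \<longlonglongrightarrow> indicator (box a b) x"
          using tendsto_bump by blast
      qed (use s in auto)
      then show ?thesis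
        using s by simp
    qed
    have "measure M (box a b) = measure N (box a b)"
      using lim[OF M] lim[OF N] eq[OF test_function_bump[OF _ that]]
      by (simp add: LIMSEQ_unique)
    then show ?thesis
      using fin[OF M that] fin[OF N that] by (simp add: emeasure_eq_ennreal_measure less_top)
  qed
  have sub: "emeasure M (A \<inter> box a b) = emeasure N (A \<inter> box a b)"
    if ab: "cbox a b \<subseteq> U" and A: "A \<in> sets borel" for a b A
  proof -
    \<comment> \<open>Restricting to a fixed box makes both measures finite, as the generator
      argument requires.\<close>
    let ?R = "\<lambda>L. density L (indicator (box a b))"
    have em: "emeasure (?R L) X = emeasure L (box a b \<inter> X)"
      if "sets L = sets borel" "X \<in> sets borel" for L X
      using that by (simp add: emeasure_restricted)
    have int: "box a b \<inter> box c d = box (\<chi> i. max (a $ i) (c $ i)) (\<chi> i. min (b $ i) (d $ i))"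
      for a b c d :: "real^'n"
      by (auto simp: mem_box_cart)
    have "?R M = ?R N"
    proof (rule measure_eqI_generator_eq)
      show "Int_stable (range (\<lambda>(a, b). box a b :: (real^'n) set))"
        by (auto simp: Int_stable_def int)
      show "sets (?R M) = sigma_sets UNIV (range (\<lambda>(a, b). box a b))"
        "sets (?R N) = sigma_sets UNIV (range (\<lambda>(a, b). box a b))"
        by (simp_all add: sets borel_eq_box)
      show "range (\<lambda>n. box (- (real n *\<^sub>R One)) (real n *\<^sub>R One))
          \<subseteq> range (\<lambda>(a, b). box a b :: (real^'n) set)"
        by auto
      show "(\<Union>n. box (- (real n *\<^sub>R One)) (real n *\<^sub>R One)) = (UNIV :: (real^'n) set)"
        by (rule UN_box_eq_UNIV)
      have "emeasure M (box a b \<inter> X) \<noteq> \<infinity>" for X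
        by (rule less_imp_neq, rule le_less_trans[OF emeasure_mono fin[OF M ab]]) (use sets in auto)
      then show "emeasure (?R M) (box (- (real n *\<^sub>R One)) (real n *\<^sub>R One)) \<noteq> \<infinity>" for n
        using sets by (simp add: em)
      fix X assume "X \<in> range (\<lambda>(a, b). box a b :: (real^'n) set)"
      then obtain c d where X: "X = box c d"
        by auto
      \<comment> \<open>The intersection of the two boxes is a box whose closed version stays inside
        \<open>cbox a b\<close>, hence inside \<open>U\<close>, so the equality on boxes applies to
        it.\<close>
      have "cbox (\<chi> i. max (a $ i) (c $ i)) (\<chi> i. min (b $ i) (d $ i)) \<subseteq> cbox a b"
        by (auto simp: mem_box_cart)
      then show "emeasure (?R M) X = emeasure (?R N) X"
        using ab sets unfolding X by (subst (1 2) em) (auto simp: int intro!: box)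
    qed auto
    then have "emeasure (?R M) A = emeasure (?R N) A"
      by simp
    then show ?thesis
      using A sets by (simp add: em Int_commute)
  qed
  fix A assume "A \<in> relatively_compact_borel U"
  then obtain K where A: "A \<in> sets borel" "A \<subseteq> K" and K: "compact K" "K \<subseteq> U"
    by (auto simp: relatively_compact_borel_def)
  let ?\<B> = "{(a, b). cbox a b \<subseteq> U}"
  have "K \<subseteq> (\<Union>(a, b)\<in>?\<B>. box a b)"
  proof
    fix x assume "x \<in> K"
    then have "x \<in> U"
      using K by blast
    then obtain a b where "cbox a b \<subseteq> U" "x \<in> box a b"
      using open_contains_cbox[OF U] by metis
    then show "x \<in> (\<Union>(a, b)\<in>?\<B>. box a b)"
      by auto
  qed
  then obtain F where F: "F \<subseteq> ?\<B>" "finite F" "K \<subseteq> (\<Union>(a, b)\<in>F. box a b)"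
    by (rule compactE_image[OF K(1), rotated]) auto
  have "emeasure M A = emeasure N A"
    if "finite F" "F \<subseteq> ?\<B>" "A \<in> sets borel" "A \<subseteq> (\<Union>(a, b)\<in>F. box a b)" for A F
    using that
  proof (induction F arbitrary: A)
    case (insert p F)
    obtain a b where p: "p = (a, b)"
      by (cases p)
    \<comment> \<open>Peeling off one box at a time keeps the pieces disjoint, whatever the overlaps
      in the cover.\<close>
    have split: "emeasure L A = emeasure L (A \<inter> box a b) + emeasure L (A - box a b)"
      if "sets L = sets borel" for L
      using that insert.prems(2) by (subst plus_emeasure) (auto simp: Int_Diff_Un)
    have "emeasure M (A - box a b) = emeasure N (A - box a b)"
      using insert.prems p by (intro insert.IH) auto
    moreover have "emeasure M (A \<inter> box a b) = emeasure N (A \<inter> box a b)"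
      using insert.prems p by (intro sub) auto
    ultimately show ?case
      unfolding split[OF sets(1)] split[OF sets(2)] by simp
  qed simp
  from this[OF F(2,1) A(1) order.trans[OF A(2) F(3)]]
  show "emeasure M A = emeasure N A" .
qed

text \<open>Both measures integrate each test function to the same number, so the positive measures
  \<open>P + N'\<close> and \<open>P' + N\<close> agree on test functions and hence
  coincide.\<close>

lemma is_distr_deriv2_unique:
  fixes U :: "(real^'n::finite) set"
  assumes U: "open U" and 1: "is_distr_deriv2 U f i j \<nu>" and 2: "is_distr_deriv2 U f i j \<nu>'"
    and A: "A \<in> relatively_compact_borel U"
  shows "\<nu> A = \<nu>' A"
proof -
  obtain P N P' N' where r: "represents_signed U P N \<nu>" "represents_signed U P' N' \<nu>'"
    using 1 2 by (auto simp: is_distr_deriv2_def signed_radon_on_def)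
  then have R: "radon_measure_on U P" "radon_measure_on U N"
    "radon_measure_on U P'" "radon_measure_on U N'"
    by (auto simp: represents_signed_def)
  then have s: "sets P = sets borel" "sets N = sets borel" "sets P' = sets borel"
    "sets N' = sets borel"
    by (auto simp: radon_measure_on_def)
  have "add_measure P N' = add_measure P' N"
  proof (rule radon_measure_eqI_test_function[OF U])
    show "radon_measure_on U (add_measure P N')" "radon_measure_on U (add_measure P' N)"
      using R by (auto intro: radon_measure_on_add)
    fix \<phi> assume \<phi>: "test_function U \<phi>"
    note int = R[THEN integrable_test_function[OF \<phi>]]
    let ?I = "LINT x:U|lborel. f x * partial i (partial j \<phi>) x"
    have "has_signed_integral U \<nu> \<phi> ?I" "has_signed_integral U \<nu>' \<phi> ?I"
      using 1 2 \<phi> by (auto simp: is_distr_deriv2_def)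
    moreover have "has_signed_integral U \<nu> \<phi> (integral\<^sup>L P \<phi> - integral\<^sup>L N \<phi>)"
      "has_signed_integral U \<nu>' \<phi> (integral\<^sup>L P' \<phi> - integral\<^sup>L N' \<phi>)"
      using r int by (auto simp: has_signed_integral_def)
    ultimately have "integral\<^sup>L P \<phi> - integral\<^sup>L N \<phi> = integral\<^sup>L P' \<phi> - integral\<^sup>L N' \<phi>"
      using has_signed_integral_unique[OF sigma_compact_open[OF U]] by metis
    then show "integral\<^sup>L (add_measure P N') \<phi> = integral\<^sup>L (add_measure P' N) \<phi>"
      by (simp add: integrable_add_measure s int)
  qed
  then have "emeasure P A + emeasure N' A = emeasure P' A + emeasure N A"
    using s by (metis emeasure_add_measure)
  then have "measure P A + measure N' A = measure P' A + measure N A"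
    using radon_measure_on_relatively_compact[OF _ A] R
    by (simp add: measure_def flip: enn2real_plus)
  then show ?thesis
    using r A by (auto simp: represents_signed_def)
qed

section \<open>Integration over the plane and along the diagonal\<close>

lemma vector_2_eq: "vector [x, y] = x *\<^sub>R axis 1 1 + y *\<^sub>R (axis 2 1 :: real^2)"
  by (simp add: vec_eq_iff forall_2 axis_def)

lemma borel_measurable_vector_2 [measurable (raw)]:
  assumes [measurable]: "f \<in> borel_measurable M" "g \<in> borel_measurable M"
  shows "(\<lambda>x. vector [f x, g x] :: real^2) \<in> borel_measurable M"
  unfolding vector_2_eq by simp

lemma has_derivative_vector_2 [derivative_intros]:
  assumes "(f has_derivative f') F" "(g has_derivative g') F"
  shows "((\<lambda>x. vector [f x, g x] :: real^2) has_derivative (\<lambda>h. vector [f' h, g' h])) F"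
  unfolding vector_2_eq using assms by (auto intro!: derivative_eq_intros)

lemma continuous_on_vector_2 [continuous_intros]:
  assumes "continuous_on S f" "continuous_on S g"
  shows "continuous_on S (\<lambda>x. vector [f x, g x] :: real^2)"
  unfolding vector_2_eq using assms by (intro continuous_intros)

text \<open>Lebesgue measure is characterised by the volumes of boxes; the identification makes
  Fubini for pairs available on \<open>real^2\<close>.\<close>

lemma lborel_vector_2:
  "lborel = distr (lborel \<Otimes>\<^sub>M lborel) borel (\<lambda>(x, y). vector [x, y] :: real^2)"
proof (rule lborel_eqI)
  fix l u :: "real^2"
  assume le: "\<And>b. b \<in> Basis \<Longrightarrow> l \<bullet> b \<le> u \<bullet> b"
  have "axis i 1 \<in> (Basis :: (real^2) set)" for i
    by (simp add: axis_in_Basis_iff)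
  then have le': "l $ i \<le> u $ i" for i
    using le[of "axis i 1"] by (simp add: inner_axis)
  have "(\<lambda>(x, y). vector [x, y]) -` box l u = {l $ 1<..<u $ 1} \<times> {l $ 2<..<u $ 2}"
    by (auto simp: mem_box_cart forall_2)
  then have "emeasure (distr (lborel \<Otimes>\<^sub>M lborel) borel (\<lambda>(x, y). vector [x, y])) (box l u)
      = ennreal ((u $ 1 - l $ 1) * (u $ 2 - l $ 2))"
    using le' by (subst emeasure_distr)
      (auto simp: space_pair_measure lborel.emeasure_pair_measure_Times ennreal_mult)
  also have "(u $ 1 - l $ 1) * (u $ 2 - l $ 2) = (\<Prod>b\<in>Basis. (u - l) \<bullet> b)"
    by (simp add: Basis_vec_def UNIV_2 axis_eq_axis inner_axis)
  finally show "emeasure (distr (lborel \<Otimes>\<^sub>M lborel) borel (\<lambda>(x, y). vector [x, y])) (box l u)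
      = (\<Prod>b\<in>Basis. (u - l) \<bullet> b)" .
qed simp

text \<open>The index in each name is the coordinate of the inner integral, that is, the direction
  in which a partial derivative will be integrated out.\<close>

lemma
  fixes f :: "real^2 \<Rightarrow> real"
  assumes f: "integrable lborel f"
  shows integral_plane_1: "(\<integral>x. f x \<partial>lborel) = (\<integral>y. \<integral>x. f (vector [x, y]) \<partial>lborel \<partial>lborel)"
    and integral_plane_2: "(\<integral>x. f x \<partial>lborel) = (\<integral>x. \<integral>y. f (vector [x, y]) \<partial>lborel \<partial>lborel)"
proof -
  let ?v = "\<lambda>(x, y). vector [x, y] :: real^2"
  have [measurable]: "f \<in> borel_measurable borel"
    using f by auto
  have "integrable (distr (lborel \<Otimes>\<^sub>M lborel) borel ?v) f"
    using f by (simp flip: lborel_vector_2)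
  then have i: "integrable (lborel \<Otimes>\<^sub>M lborel) (\<lambda>(x, y). f (vector [x, y]))"
    by (subst (asm) integrable_distr_eq) (auto simp: case_prod_beta')
  have "(\<integral>x. f x \<partial>lborel) = (\<integral>p. f (?v p) \<partial>(lborel \<Otimes>\<^sub>M lborel))"
    by (subst lborel_vector_2, subst integral_distr) auto
  also have "\<dots> = (\<integral>(x, y). f (vector [x, y]) \<partial>(lborel \<Otimes>\<^sub>M lborel))"
    by (simp add: case_prod_beta')
  finally show "(\<integral>x. f x \<partial>lborel) = (\<integral>y. \<integral>x. f (vector [x, y]) \<partial>lborel \<partial>lborel)"
    "(\<integral>x. f x \<partial>lborel) = (\<integral>x. \<integral>y. f (vector [x, y]) \<partial>lborel \<partial>lborel)"
    using lborel_pair.integral_snd[OF i] lborel_pair.integral_fst[OF i] by simp_all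
qed

lemma set_integrable_continuous_on_compact:
  fixes f :: "'a::euclidean_space \<Rightarrow> real"
  assumes K: "compact K" and f: "continuous_on K f"
    and M: "sets M = sets borel" "emeasure M K < \<infinity>"
  shows "set_integrable M K f"
proof -
  have "bounded (f ` K)"
    using K f by (simp add: compact_continuous_image compact_imp_bounded)
  then obtain B where B: "\<forall>x\<in>K. \<bar>f x\<bar> \<le> B"
    by (auto simp: bounded_iff)
  have KB: "K \<in> sets borel"
    using K by (rule borel_compact)
  show ?thesis
    unfolding set_integrable_def
  proof (rule Bochner_Integration.integrable_bound)
    show "integrable M (\<lambda>x. B * indicator K x)"
      using M KB by simp
    have "(\<lambda>x. indicator K x *\<^sub>R f x) \<in> borel_measurable borel"
      using KB f by (rule borel_measurable_continuous_on_indicator)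
    then show "(\<lambda>x. indicator K x *\<^sub>R f x) \<in> borel_measurable M"
      using M by (simp cong: measurable_cong_sets)
    show "AE x in M. norm (indicator K x *\<^sub>R f x) \<le> norm (B * indicator K x)"
      using B by (force split: split_indicator)
  qed
qed

section \<open>Arc length on the diagonal\<close>

lemma sets_diagonal_arc_length [simp, measurable_cong]:
  "sets (diagonal_arc_length \<alpha>) = sets borel"
  by (simp add: diagonal_arc_length_def arc_length_measure_def)

lemma diagonal_arc_length_eq:
  "diagonal_arc_length \<alpha> =
    distr (density lborel (\<lambda>t. ennreal (indicator {0..} t * sqrt (1 + \<alpha>\<^sup>2)))) borel
      (\<lambda>t. vector [\<alpha> * t, t])"
proof -
  have "((\<lambda>t. vector [\<alpha> * t, t] :: real^2) has_vector_derivative vector [\<alpha>, 1]) (at t)" for t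
    unfolding has_vector_derivative_def
    by (auto intro!: derivative_eq_intros simp: vec_eq_iff forall_2 fun_eq_iff)
  then have "vector_derivative (\<lambda>t. vector [\<alpha> * t, t] :: real^2) (at t) = vector [\<alpha>, 1]" for t
    by (rule vector_derivative_at)
  moreover have "norm (vector [\<alpha>, 1] :: real^2) = sqrt (1 + \<alpha>\<^sup>2)"
    by (simp add: norm_vec_def L2_set_def sum_2 add.commute)
  ultimately show ?thesis
    by (simp add: diagonal_arc_length_def arc_length_measure_def)
qed

lemma integral_diagonal_arc_length:
  fixes f :: "real^2 \<Rightarrow> real"
  assumes [measurable]: "f \<in> borel_measurable borel"
  shows "integral\<^sup>L (diagonal_arc_length \<alpha>) f =
      sqrt (1 + \<alpha>\<^sup>2) * (\<integral>t. indicator {0..} t * f (vector [\<alpha> * t, t]) \<partial>lborel)"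
proof -
  have "integral\<^sup>L (diagonal_arc_length \<alpha>) f =
      (\<integral>t. sqrt (1 + \<alpha>\<^sup>2) * (indicator {0..} t * f (vector [\<alpha> * t, t])) \<partial>lborel)"
    unfolding diagonal_arc_length_eq
    by (subst integral_distr) (auto simp: integral_density ac_simps simp del: integral_mult_right_zero)
  then show ?thesis
    by simp
qed

text \<open>The parameter \<open>t = 0\<close> is a null set. For positive \<alpha> its removal puts
  almost every point in the open quadrant, so the axes carry no arc length.\<close>

lemma AE_diagonal_arc_length: "AE x in diagonal_arc_length \<alpha>. 0 < x $ 2 \<and> x $ 1 = \<alpha> * x $ 2"
  unfolding diagonal_arc_length_eq using AE_lborel_singleton[of "0::real"]
  by (subst AE_distr_iff)
    (auto simp: AE_density elim!: eventually_mono split: split_indicator)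

text \<open>The parameter is the second coordinate of the point, so a norm bound on \<open>K\<close>
  confines it to a bounded interval.\<close>

lemma emeasure_diagonal_arc_length_compact:
  assumes K: "compact K"
  shows "emeasure (diagonal_arc_length \<alpha>) K < \<infinity>"
proof -
  have [measurable]: "K \<in> sets borel"
    using K by (rule borel_compact)
  obtain B where B: "\<forall>x\<in>K. norm x \<le> B"
    using K by (auto dest!: compact_imp_bounded simp: bounded_iff)
  have "emeasure (diagonal_arc_length \<alpha>) K =
      (\<integral>\<^sup>+t. ennreal (indicator {0..} t * sqrt (1 + \<alpha>\<^sup>2)) * indicator K (vector [\<alpha> * t, t]) \<partial>lborel)"
    unfolding diagonal_arc_length_eq
    using measurable_sets_borel[OF _ \<open>K \<in> sets borel\<close>, of "\<lambda>t. vector [\<alpha> * t, t]"]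
    by (subst emeasure_distr)
      (auto simp: emeasure_density intro!: nn_integral_cong split: split_indicator)
  also have "\<dots> \<le> (\<integral>\<^sup>+t. ennreal (sqrt (1 + \<alpha>\<^sup>2)) * indicator {- B..B} t \<partial>lborel)"
  proof (rule nn_integral_mono)
    fix t
    have "\<bar>t\<bar> \<le> B" if "vector [\<alpha> * t, t] \<in> K"
      using bspec[OF B that] component_le_norm_cart[of "vector [\<alpha> * t, t] :: real^2" 2] by simp
    then show "ennreal (indicator {0..} t * sqrt (1 + \<alpha>\<^sup>2)) * indicator K (vector [\<alpha> * t, t])
        \<le> ennreal (sqrt (1 + \<alpha>\<^sup>2)) * indicator {- B..B} t"
      by (force split: split_indicator)
  qed
  also have "\<dots> < \<infinity>"
    by (simp add: nn_integral_cmult ennreal_mult_less_top emeasure_lborel_Icc_eq)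
  finally show ?thesis .
qed


section \<open>Distributional second derivatives of the payoff\<close>

text \<open>The one-dimensional calculus behind everything that follows: the jump of a half-line
  indicator yields a point value, and the kink of \<open>max t b\<close> yields the indicator of a
  half-line.\<close>

lemma
  fixes g g' :: "real \<Rightarrow> real"
  assumes g: "\<And>t. (g has_real_derivative g' t) (at t)" and g': "continuous_on UNIV g'"
    and supp: "\<And>t. \<bar>t\<bar> \<ge> R \<Longrightarrow> g t = 0 \<and> g' t = 0"
  shows integral_deriv_greaterThan: "(\<integral>t. indicator {b<..} t * g' t \<partial>lborel) = - g b"
    and integral_deriv_lessThan: "(\<integral>t. indicator {..<b} t * g' t \<partial>lborel) = g b"
    and integral_max_deriv: "(\<integral>t. max t b * g' t \<partial>lborel) = - (\<integral>t. indicator {b<..} t * g t \<partial>lborel)"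
proof -
  have gc: "continuous_on A g" for A
    using g by (meson DERIV_continuous_on DERIV_subset UNIV_I continuous_on_subset top_greatest)
  have gc': "isCont g' t" for t
    using g' by (simp add: continuous_on_eq_continuous_at)
  have [measurable]: "g \<in> borel_measurable borel" "g' \<in> borel_measurable borel"
    using gc g' by (auto intro: borel_measurable_continuous_onI)
  \<comment> \<open>The interval from \<open>-M\<close> to \<open>M\<close> contains the support as
    well as the break point \<open>b\<close>.\<close>
  define M where "M = max R \<bar>b\<bar>"
  have M: "- M \<le> b" "b \<le> M" and sM: "\<And>t. \<bar>t\<bar> \<ge> M \<Longrightarrow> g t = 0 \<and> g' t = 0"
    using supp by (auto simp: M_def)
  \<comment> \<open>Half-lines are exchanged for closed intervals to apply the fundamental theorem
    of calculus; the discrepancy is at \<open>b\<close> or where \<open>g\<close> and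
    \<open>g'\<close> vanish.\<close>
  have AEb: "AE t in lborel. t \<noteq> b"
    by (rule AE_lborel_singleton)
  have "(\<integral>t. indicator {b<..} t * g' t \<partial>lborel) = (\<integral>t. g' t * indicator {b..M} t \<partial>lborel)"
    using AEb sM by (intro integral_cong_AE) (auto elim!: eventually_mono split: split_indicator)
  also have "\<dots> = g M - g b"
    using M g gc' by (intro integral_FTC_Icc_real) auto
  finally show gt: "(\<integral>t. indicator {b<..} t * g' t \<partial>lborel) = - g b"
    using sM[of M] M by simp
  have "(\<integral>t. indicator {..<b} t * g' t \<partial>lborel) = (\<integral>t. g' t * indicator {- M..b} t \<partial>lborel)"
    using AEb sM by (intro integral_cong_AE) (auto elim!: eventually_mono split: split_indicator)
  also have "\<dots> = g b - g (- M)"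
    using M g gc' by (intro integral_FTC_Icc_real) auto
  finally show "(\<integral>t. indicator {..<b} t * g' t \<partial>lborel) = g b"
    using sM[of "- M"] M by simp
  have int: "integrable lborel (\<lambda>t. f t * indicator {c..M} t)" if "continuous_on UNIV f"
    for f :: "real \<Rightarrow> real" and c
    using borel_integrable_compact[of "{c..M}" f] continuous_on_subset[OF that]
    by (simp add: mult.commute)
  have c: "continuous_on UNIV (\<lambda>t. b * g' t)" "continuous_on UNIV (\<lambda>t. (t - b) * g' t)"
    "continuous_on UNIV g" "continuous_on UNIV (\<lambda>t. (t - b) * g' t + g t)"
    using g' gc by (auto intro!: continuous_intros)
  \<comment> \<open>\<open>max t b\<close> is \<open>b\<close> plus the positive part of
    \<open>t - b\<close>; the constant contributes the integral of a derivative with compact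
    support, which is 0.\<close>
  have "(\<integral>t. max t b * g' t \<partial>lborel) =
      (\<integral>t. b * g' t * indicator {- M..M} t + (t - b) * g' t * indicator {b..M} t \<partial>lborel)"
    using sM M by (intro Bochner_Integration.integral_cong)
      (auto simp: max_def algebra_simps split: split_indicator)
  also have "\<dots> = b * (\<integral>t. g' t * indicator {- M..M} t \<partial>lborel)
      + (\<integral>t. (t - b) * g' t * indicator {b..M} t \<partial>lborel)"
    by (subst Bochner_Integration.integral_add[OF int[OF c(1)] int[OF c(2)]]) (simp add: mult.assoc)
  also have "(\<integral>t. g' t * indicator {- M..M} t \<partial>lborel) = g M - g (- M)"
    using M g gc' by (intro integral_FTC_Icc_real) auto
  also have "\<dots> = 0"
    using sM[of M] sM[of "- M"] M by simp
  \<comment> \<open>Integration by parts: \<open>(t - b) * g' t + g t\<close> is the derivative of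
    \<open>(t - b) * g t\<close>, which vanishes at \<open>b\<close> by its first factor and at
    \<open>M\<close> by its second.\<close>
  also have "(\<integral>t. (t - b) * g' t * indicator {b..M} t \<partial>lborel) =
      (\<integral>t. ((t - b) * g' t + g t) * indicator {b..M} t \<partial>lborel)
      - (\<integral>t. g t * indicator {b..M} t \<partial>lborel)"
    by (subst Bochner_Integration.integral_diff[OF int[OF c(4)] int[OF c(3)], symmetric])
      (simp add: algebra_simps)
  also have "(\<integral>t. ((t - b) * g' t + g t) * indicator {b..M} t \<partial>lborel)
      = (M - b) * g M - (b - b) * g b"
    using M g gc' gc[of UNIV]
    by (intro integral_FTC_Icc_real)
      (auto intro!: derivative_eq_intros continuous_intros simp: continuous_on_eq_continuous_at)
  also have "\<dots> = 0"
    using sM[of M] M by simp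
  also have "(\<integral>t. g t * indicator {b..M} t \<partial>lborel) = (\<integral>t. indicator {b<..} t * g t \<partial>lborel)"
    using AEb sM by (intro integral_cong_AE) (auto elim!: eventually_mono split: split_indicator)
  finally show "(\<integral>t. max t b * g' t \<partial>lborel) = - (\<integral>t. indicator {b<..} t * g t \<partial>lborel)"
    by simp
qed

text \<open>Satisfied by a test function and also by its first partial derivatives, so one
  integration by parts can be applied twice in succession.\<close>

definition C1_compact_support :: "(real^'n::finite \<Rightarrow> real) \<Rightarrow> bool" where
  "C1_compact_support f \<longleftrightarrow> (\<forall>x. f differentiable (at x)) \<and>
     (\<forall>i. continuous_on UNIV (partial i f)) \<and> bounded {x. f x \<noteq> 0}"

text \<open>Off the closed support the function vanishes on a whole neighbourhood, which forces the
  derivative to be 0.\<close>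

lemma partial_support: "{x. partial i f x \<noteq> 0} \<subseteq> closure {x. f x \<noteq> 0}"
proof
  fix x assume x: "x \<in> {x. partial i f x \<noteq> 0}"
  show "x \<in> closure {x. f x \<noteq> 0}"
  proof (rule ccontr)
    assume nin: "x \<notin> closure {x. f x \<noteq> 0}"
    have f0: "0 = f y" if "y \<in> - closure {x. f x \<noteq> 0}" for y
      using that closure_subset[of "{x. f x \<noteq> 0}"] by auto
    have "(f has_derivative (\<lambda>h. 0)) (at x)"
      by (rule has_derivative_transform_within_open
          [OF has_derivative_const open_Compl[OF closed_closure] _ f0]) (use nin in simp)
    from partial_eqI[OF this] show False
      using x by simp
  qed
qed

lemma C1_compact_support_bound:
  fixes f :: "real^'n::finite \<Rightarrow> real"
  assumes "C1_compact_support f"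
  obtains R where "\<And>x i j. \<bar>x $ i\<bar> \<ge> R \<Longrightarrow> f x = 0 \<and> partial j f x = 0"
proof -
  have "bounded (closure {x. f x \<noteq> 0})"
    using assms by (simp add: C1_compact_support_def bounded_closure)
  then obtain B where B: "\<forall>x\<in>closure {x. f x \<noteq> 0}. norm x \<le> B"
    by (auto simp: bounded_iff)
  show ?thesis
  proof (rule that)
    fix x :: "real^'n" and i j
    \<comment> \<open>The added 1 turns the non-strict bound into a point strictly outside the ball
      of radius \<open>B\<close>.\<close>
    assume "\<bar>x $ i\<bar> \<ge> B + 1"
    then have "x \<notin> closure {x. f x \<noteq> 0}"
      using B component_le_norm_cart[of x i] by force
    then show "f x = 0 \<and> partial j f x = 0"
      using partial_support[of j f] closure_subset[of "{x. f x \<noteq> 0}"] by auto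
  qed
qed

lemma
  assumes "test_function U \<phi>"
  shows test_function_C1: "C1_compact_support \<phi>"
    and test_function_partial_C1: "C1_compact_support (partial j \<phi>)"
proof -
  have "C_k 2 \<phi>"
    using assms by (simp add: test_function_def)
  then have C: "\<And>x. \<phi> differentiable (at x)" "\<And>j x. partial j \<phi> differentiable (at x)"
    "\<And>i j. continuous_on UNIV (partial i (partial j \<phi>))"
    by (auto simp: numeral_2_eq_2)
  have b: "bounded (closure {x. \<phi> x \<noteq> 0})"
    using assms by (auto simp: test_function_def compact_imp_bounded)
  show "C1_compact_support \<phi>"
    using C(1,2) bounded_subset[OF b closure_subset]
    by (auto simp: C1_compact_support_def
        intro!: continuous_at_imp_continuous_on differentiable_imp_continuous_within)
  show "C1_compact_support (partial j \<phi>)"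
    using C(2,3) bounded_subset[OF b partial_support[of j \<phi>]]
    by (simp add: C1_compact_support_def)
qed

lemma integrable_mult_bounded_support:
  fixes f :: "real^'n::finite \<Rightarrow> real"
  assumes f: "continuous_on UNIV f" and supp: "bounded {x. f x \<noteq> 0}"
    and w: "continuous_on UNIV w"
  shows "integrable lborel (\<lambda>x. w x * f x)"
proof -
  have "compact (closure {x. f x \<noteq> 0})"
    using supp by (simp add: compact_closure)
  then have "integrable lborel (\<lambda>x. indicator (closure {x. f x \<noteq> 0}) x *\<^sub>R (w x * f x))"
    using f w by (intro borel_integrable_compact continuous_on_mult)
      (auto intro: continuous_on_subset)
  moreover have "indicator (closure {x. f x \<noteq> 0}) x *\<^sub>R (w x * f x) = w x * f x" for x
    using closure_subset[of "{x. f x \<noteq> 0}"] by (auto split: split_indicator)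
  ultimately show ?thesis
    by (simp only:)
qed

lemma continuous_on_payoff: "continuous_on A (payoff \<alpha>)"
  unfolding payoff_def by (intro continuous_intros)

context
  fixes f :: "real^2 \<Rightarrow> real" and \<alpha> :: real
  assumes f: "C1_compact_support f" and \<alpha>: "\<alpha> > 0"
begin

lemma C1_continuous: "continuous_on UNIV f" "continuous_on UNIV (partial i f)"
  using f by (auto simp: C1_compact_support_def intro!: continuous_at_imp_continuous_on
      differentiable_imp_continuous_within)

lemma C1_slice:
  "((\<lambda>t. f (vector [t, y])) has_real_derivative partial 1 f (vector [t, y])) (at t)"
  "((\<lambda>t. f (vector [x, t])) has_real_derivative partial 2 f (vector [x, t])) (at t)"
proof -
  have D: "(f has_derivative frechet_derivative f (at z)) (at z)" for z
    using f by (auto simp: C1_compact_support_def intro: has_derivative_partial)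
  have lin: "frechet_derivative f (at z) (c *\<^sub>R v) = c * frechet_derivative f (at z) v" for z c v
    using linear_scale[OF has_derivative_linear[OF D]] by simp
  have "((\<lambda>t. f (vector [t, y])) has_derivative
      (\<lambda>h. frechet_derivative f (at (vector [t, y])) (vector [h, 0]))) (at t)"
    by (rule has_derivative_compose[OF _ D]) (auto intro!: derivative_eq_intros)
  then show "((\<lambda>t. f (vector [t, y])) has_real_derivative partial 1 f (vector [t, y])) (at t)"
    by (simp add: has_field_derivative_def partial_def vector_2_eq lin mult_commute_abs)
  have "((\<lambda>t. f (vector [x, t])) has_derivative
      (\<lambda>h. frechet_derivative f (at (vector [x, t])) (vector [0, h]))) (at t)"
    by (rule has_derivative_compose[OF _ D]) (auto intro!: derivative_eq_intros)
  then show "((\<lambda>t. f (vector [x, t])) has_real_derivative partial 2 f (vector [x, t])) (at t)"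
    by (simp add: has_field_derivative_def partial_def vector_2_eq lin mult_commute_abs)
qed

lemma C1_integrable:
  assumes "A \<in> sets borel" "continuous_on UNIV w"
  shows "integrable lborel (\<lambda>x. indicator A x * (w x * f x))"
    "integrable lborel (\<lambda>x. indicator A x * (w x * partial i f x))"
proof -
  have b: "bounded (closure {x. f x \<noteq> 0})"
    using f by (simp add: C1_compact_support_def bounded_closure)
  have "integrable lborel (\<lambda>x. w x * f x)" "integrable lborel (\<lambda>x. w x * partial i f x)"
    using assms(2) bounded_subset[OF b partial_support] bounded_subset[OF b closure_subset]
    by (auto intro!: integrable_mult_bounded_support C1_continuous)
  then show "integrable lborel (\<lambda>x. indicator A x * (w x * f x))"
    "integrable lborel (\<lambda>x. indicator A x * (w x * partial i f x))"
    using assms(1) integrable_mult_indicator[of A lborel "\<lambda>x. w x * f x"]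
      integrable_mult_indicator[of A lborel "\<lambda>x. w x * partial i f x"] by simp_all
qed

abbreviation right_region :: "(real^2) set" where "right_region \<equiv> {x. x $ 1 > \<alpha> * x $ 2}"
abbreviation left_region :: "(real^2) set" where "left_region \<equiv> {x. x $ 1 < \<alpha> * x $ 2}"

text \<open>Horizontal lines cross the diagonal at \<alpha> y and vertical ones at x / \<alpha>.
  Taking \<alpha> out of the maximum leaves unit slope on vertical lines, the form handled by
  \<open>integral_max_deriv\<close>.\<close>

lemma slice_simps:
  "indicator right_region (vector [x, y]) = (indicator {\<alpha> * y<..} x :: real)"
  "indicator right_region (vector [x, y]) = (indicator {..<x / \<alpha>} y :: real)"
  "indicator left_region (vector [x, y]) = (indicator {..<\<alpha> * y} x :: real)"
  "indicator left_region (vector [x, y]) = (indicator {x / \<alpha><..} y :: real)"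
  "payoff \<alpha> (vector [x, y]) = max x (\<alpha> * y)"
  "payoff \<alpha> (vector [x, y]) = \<alpha> * max y (x / \<alpha>)"
  using \<alpha> by (auto simp: payoff_def field_simps max_def split: split_indicator)

lemma integral_diagonal_reparam:
  "(\<integral>x. f (vector [x, x / \<alpha>]) \<partial>lborel) = \<alpha> * (\<integral>t. f (vector [\<alpha> * t, t]) \<partial>lborel)"
  using \<alpha> by (subst lborel_integral_real_affine[of \<alpha> _ 0]) auto

text \<open>Distributionally, the indicator of the right region has gradient \<open>n\<close> times
  integration in \<open>t\<close> along the line, the left one has the opposite gradient, and the
  payoff has as its partials the right indicator and \<alpha> times the left one.\<close>

lemma integral_region_partial:
  "(\<integral>x. indicator right_region x * partial 1 f x \<partial>lborel) = - (\<integral>t. f (vector [\<alpha> * t, t]) \<partial>lborel)"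
  "(\<integral>x. indicator right_region x * partial 2 f x \<partial>lborel) = \<alpha> * (\<integral>t. f (vector [\<alpha> * t, t]) \<partial>lborel)"
  "(\<integral>x. indicator left_region x * partial 1 f x \<partial>lborel) = (\<integral>t. f (vector [\<alpha> * t, t]) \<partial>lborel)"
  "(\<integral>x. indicator left_region x * partial 2 f x \<partial>lborel) = - \<alpha> * (\<integral>t. f (vector [\<alpha> * t, t]) \<partial>lborel)"
  and integral_payoff_partial:
  "(\<integral>x. payoff \<alpha> x * partial 1 f x \<partial>lborel) = - (\<integral>x. indicator right_region x * f x \<partial>lborel)"
  "(\<integral>x. payoff \<alpha> x * partial 2 f x \<partial>lborel) = - \<alpha> * (\<integral>x. indicator left_region x * f x \<partial>lborel)"
proof -
  \<comment> \<open>One radius serves all lines at once because it bounds every coordinate.\<close>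
  obtain R where R: "\<And>x i j. \<bar>x $ i\<bar> \<ge> R \<Longrightarrow> f x = 0 \<and> partial j f x = 0"
    using C1_compact_support_bound[OF f] by metis
  have supp1: "f (vector [t, y]) = 0 \<and> partial 1 f (vector [t, y]) = 0"
    and supp2: "f (vector [x, t]) = 0 \<and> partial 2 f (vector [x, t]) = 0"
    if "R \<le> \<bar>t\<bar>" for t x y
    using that R[where x = "vector [t, y]" and i = 1] R[where x = "vector [x, t]" and i = 2] by auto
  have cont1: "continuous_on UNIV (\<lambda>t. partial 1 f (vector [t, y]))"
    and cont2: "continuous_on UNIV (\<lambda>t. partial 2 f (vector [x, t]))" for x y
    by (auto intro!: continuous_on_compose2[OF C1_continuous(2)] continuous_intros)
  note line1 = C1_slice(1) cont1 supp1
  note line2 = C1_slice(2) cont2 supp2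
  have [measurable]: "right_region \<in> sets borel" "left_region \<in> sets borel"
    by measurable
  have int: "integrable lborel (\<lambda>x. indicator right_region x * partial i f x)"
    "integrable lborel (\<lambda>x. indicator left_region x * partial i f x)"
    "integrable lborel (\<lambda>x. indicator right_region x * f x)"
    "integrable lborel (\<lambda>x. indicator left_region x * f x)"
    "integrable lborel (\<lambda>x. payoff \<alpha> x * partial i f x)" for i
    using C1_integrable[of right_region "\<lambda>_. 1"] C1_integrable[of left_region "\<lambda>_. 1"]
      C1_integrable(2)[of UNIV "payoff \<alpha>"] continuous_on_payoff by auto
  show "(\<integral>x. indicator right_region x * partial 1 f x \<partial>lborel) = - (\<integral>t. f (vector [\<alpha> * t, t]) \<partial>lborel)"
    by (simp add: integral_plane_1[OF int(1)] slice_simps(1) integral_deriv_greaterThan[OF line1])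
  show "(\<integral>x. indicator right_region x * partial 2 f x \<partial>lborel) = \<alpha> * (\<integral>t. f (vector [\<alpha> * t, t]) \<partial>lborel)"
    by (simp add: integral_plane_2[OF int(1)] slice_simps(2) integral_deriv_lessThan[OF line2]
        integral_diagonal_reparam)
  show "(\<integral>x. indicator left_region x * partial 1 f x \<partial>lborel) = (\<integral>t. f (vector [\<alpha> * t, t]) \<partial>lborel)"
    by (simp add: integral_plane_1[OF int(2)] slice_simps(3) integral_deriv_lessThan[OF line1])
  show "(\<integral>x. indicator left_region x * partial 2 f x \<partial>lborel) = - \<alpha> * (\<integral>t. f (vector [\<alpha> * t, t]) \<partial>lborel)"
    by (simp add: integral_plane_2[OF int(2)] slice_simps(4) integral_deriv_greaterThan[OF line2]
        integral_diagonal_reparam)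
  show "(\<integral>x. payoff \<alpha> x * partial 1 f x \<partial>lborel) = - (\<integral>x. indicator right_region x * f x \<partial>lborel)"
    by (simp add: integral_plane_1[OF int(5)] integral_plane_1[OF int(3)] slice_simps(1,5)
        integral_max_deriv[OF line1])
  show "(\<integral>x. payoff \<alpha> x * partial 2 f x \<partial>lborel) = - \<alpha> * (\<integral>x. indicator left_region x * f x \<partial>lborel)"
    by (simp only: integral_plane_2[OF int(5)] integral_plane_2[OF int(4)] slice_simps(4,6)
        integral_max_deriv[OF line2] mult.assoc integral_mult_right_zero) simp
qed

end

text \<open>Two integrations by parts: the outer derivative, applied with
  \<open>partial j \<phi>\<close> as integrand, turns the payoff into a region indicator, and the
  inner one, applied with \<open>\<phi>\<close>, turns that into the line integral. The four sign
  patterns combine to the product of normal components.\<close>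

lemma integral_payoff_partial2:
  assumes \<alpha>: "\<alpha> > 0" and \<phi>: "test_function U \<phi>"
  shows "(\<integral>x. payoff \<alpha> x * partial i (partial j \<phi>) x \<partial>lborel) =
    diagonal_normal \<alpha> $ i * diagonal_normal \<alpha> $ j * (\<integral>t. \<phi> (vector [\<alpha> * t, t]) \<partial>lborel)"
proof -
  have "diagonal_normal \<alpha> $ 1 = 1" "diagonal_normal \<alpha> $ 2 = - \<alpha>"
    by (simp_all add: diagonal_normal_def)
  then show ?thesis
    using exhaust_2[of i] exhaust_2[of j]
    by (elim disjE)
      (simp_all add: integral_payoff_partial[OF test_function_partial_C1[OF \<phi>] \<alpha>]
        integral_region_partial[OF test_function_C1[OF \<phi>] \<alpha>])
qed

section \<open>The second derivatives as measures on the quadrant\<close>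

lemma open_open_quadrant: "open open_quadrant"
  unfolding open_quadrant_def forall_2
  by (intro open_Collect_conj open_Collect_less continuous_intros)

lemma closed_quadrant: "closed quadrant"
  unfolding quadrant_def forall_2
  by (intro closed_Collect_conj closed_Collect_le continuous_intros)

lemma quadrant_borel [measurable]: "quadrant \<in> sets borel" "open_quadrant \<in> sets borel"
  using closed_quadrant open_open_quadrant by auto

lemma sigma_compact_quadrant: "sigma_compact quadrant" "sigma_compact open_quadrant"
  using closed_quadrant open_open_quadrant
  by (auto intro: sigma_compact_closed sigma_compact_open)

lemma open_quadrant_subset: "open_quadrant \<subseteq> quadrant"
  by (auto simp: open_quadrant_def quadrant_def less_imp_le)

text \<open>Density with respect to arc length; the division cancels the speed of
  \<open>t -> (\<alpha> t, t)\<close>.\<close>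

definition distr_density :: "real \<Rightarrow> 2 \<Rightarrow> 2 \<Rightarrow> real" where
  "distr_density \<alpha> i j = diagonal_normal \<alpha> $ i * diagonal_normal \<alpha> $ j / sqrt (1 + \<alpha>\<^sup>2)"

lemma set_integrable_diagonal_const:
  assumes "compact K"
  shows "set_integrable (diagonal_arc_length \<alpha>) K (\<lambda>x. k :: real)"
  using assms emeasure_diagonal_arc_length_compact
  by (intro set_integrable_continuous_on_compact) auto

lemma is_distr_deriv2_payoff:
  assumes \<alpha>: "\<alpha> > 0"
  shows "is_distr_deriv2 open_quadrant (payoff \<alpha>) i j
    (\<lambda>A. LINT x:A|diagonal_arc_length \<alpha>. distr_density \<alpha> i j)"
  unfolding is_distr_deriv2_def
proof (intro conjI allI impI)
  let ?k = "distr_density \<alpha> i j"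
  show "set_integrable lborel K (payoff \<alpha>)" if "compact K \<and> K \<subseteq> open_quadrant" for K
    unfolding set_integrable_def
    using that by (intro borel_integrable_compact continuous_on_payoff) auto
  have meas: "(\<lambda>x. indicator open_quadrant x * ?k) \<in> borel_measurable borel"
    by measurable
  show "signed_radon_on open_quadrant (\<lambda>A. LINT x:A|diagonal_arc_length \<alpha>. ?k)"
    using sigma_compact_quadrant meas set_integrable_diagonal_const
    by (intro signed_radon_on_density) auto
  fix \<phi> :: "real^2 \<Rightarrow> real"
  assume \<phi>: "test_function open_quadrant \<phi>"
  define K where "K = closure {x. \<phi> x \<noteq> 0}"
  have K: "compact K" "K \<subseteq> open_quadrant"
    using \<phi> by (auto simp: test_function_def K_def)
  have zero: "\<phi> x = 0" if "x \<notin> K" for x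
    using that closure_subset[of "{x. \<phi> x \<noteq> 0}"] unfolding K_def by auto
  \<comment> \<open>\<open>K\<close> is closed, so differentiating twice does not lead out of
    it.\<close>
  have "closure {x. partial j \<phi> x \<noteq> 0} \<subseteq> K"
    unfolding K_def using partial_support by (intro closure_minimal) auto
  then have zero2: "partial i (partial j \<phi>) x = 0" if "x \<notin> open_quadrant" for x
    using that K partial_support[of i "partial j \<phi>"] by auto
  have c: "continuous_on UNIV \<phi>"
    using \<phi> by (rule test_function_continuous)
  have [measurable]: "\<phi> \<in> borel_measurable borel"
    using c by (rule borel_measurable_continuous_onI)
  have "set_integrable (diagonal_arc_length \<alpha>) K (\<lambda>x. ?k * \<phi> x)"
    using K c emeasure_diagonal_arc_length_compact
    by (intro set_integrable_continuous_on_compact)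
      (auto intro!: continuous_intros intro: continuous_on_subset)
  moreover have "(\<lambda>x. indicator K x *\<^sub>R (?k * \<phi> x)) =
      (\<lambda>x. indicator open_quadrant x *\<^sub>R (?k * \<phi> x))"
    using K zero by (auto simp: fun_eq_iff indicator_def)
  ultimately have int: "set_integrable (diagonal_arc_length \<alpha>) open_quadrant (\<lambda>x. ?k * \<phi> x)"
    by (simp only: set_integrable_def)
  have signed: "has_signed_integral open_quadrant (\<lambda>A. LINT x:A|diagonal_arc_length \<alpha>. ?k) \<phi>
      (LINT x:open_quadrant|diagonal_arc_length \<alpha>. ?k * \<phi> x)"
    using sigma_compact_quadrant meas set_integrable_diagonal_const int
    by (intro has_signed_integral_density) auto
  have "(LINT x:open_quadrant|diagonal_arc_length \<alpha>. ?k * \<phi> x) =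
      sqrt (1 + \<alpha>\<^sup>2) * (\<integral>t. indicator {0..} t *
        (indicator open_quadrant (vector [\<alpha> * t, t]) *\<^sub>R (?k * \<phi> (vector [\<alpha> * t, t]))) \<partial>lborel)"
    unfolding set_lebesgue_integral_def by (rule integral_diagonal_arc_length) measurable
  \<comment> \<open>The line functional runs over all real \<open>t\<close>, arc length over
    \<open>t \<ge> 0\<close>; they agree since \<open>\<phi>\<close> vanishes outside the open
    quadrant, in particular for \<open>t \<le> 0\<close>.\<close>
  also have "(\<lambda>t. indicator {0..} t *
        (indicator open_quadrant (vector [\<alpha> * t, t]) *\<^sub>R (?k * \<phi> (vector [\<alpha> * t, t]))))
      = (\<lambda>t. ?k * \<phi> (vector [\<alpha> * t, t]))"
  proof
    fix t
    show "indicator {0..} t *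
        (indicator open_quadrant (vector [\<alpha> * t, t]) *\<^sub>R (?k * \<phi> (vector [\<alpha> * t, t])))
      = ?k * \<phi> (vector [\<alpha> * t, t])"
    proof (cases "t > 0")
      case True
      then show ?thesis
        using \<alpha> by (simp add: open_quadrant_def forall_2)
    next
      case False
      then have "vector [\<alpha> * t, t] \<notin> open_quadrant"
        by (simp add: open_quadrant_def forall_2)
      then have "\<phi> (vector [\<alpha> * t, t]) = 0"
        using zero K by blast
      then show ?thesis
        by simp
    qed
  qed
  also have "sqrt (1 + \<alpha>\<^sup>2) * (\<integral>t. ?k * \<phi> (vector [\<alpha> * t, t]) \<partial>lborel) =
      (\<integral>x. payoff \<alpha> x * partial i (partial j \<phi>) x \<partial>lborel)"
  proof -
    have "sqrt (1 + \<alpha>\<^sup>2) \<noteq> 0"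
      using real_sqrt_gt_zero[of "1 + \<alpha>\<^sup>2"] by (simp add: add_nonneg_eq_0_iff)
    then show ?thesis
      by (simp add: integral_payoff_partial2[OF \<alpha> \<phi>] distr_density_def)
  qed
  also have "\<dots> = (LINT x:open_quadrant|lborel. payoff \<alpha> x * partial i (partial j \<phi>) x)"
    unfolding set_lebesgue_integral_def using zero2
    by (intro Bochner_Integration.integral_cong) (auto split: split_indicator)
  finally show "has_signed_integral open_quadrant
      (\<lambda>A. LINT x:A|diagonal_arc_length \<alpha>. ?k) \<phi>
      (LINT x:open_quadrant|lborel. payoff \<alpha> x * partial i (partial j \<phi>) x)"
    using signed by (simp only:)
qed

text \<open>The explicit measure proves existence, so the choice in \<open>distr_deriv2\<close>
  picks a genuine derivative.\<close>

lemma is_distr_deriv2_distr_deriv2: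
  assumes "\<alpha> > 0"
  shows "is_distr_deriv2 open_quadrant (payoff \<alpha>) i j (distr_deriv2 open_quadrant (payoff \<alpha>) i j)"
  unfolding distr_deriv2_def
  by (rule someI[where P = "is_distr_deriv2 open_quadrant (payoff \<alpha>) i j"])
    (rule is_distr_deriv2_payoff[OF assms])

lemma relatively_compact_quadrant_integrable:
  fixes g :: "real^2 \<Rightarrow> real"
  assumes A: "A \<in> relatively_compact_borel quadrant" and B: "B \<in> sets borel" "B \<subseteq> A"
    and g: "continuous_on quadrant g"
  shows "set_integrable lborel B g" "set_integrable (diagonal_arc_length \<alpha>) B g"
proof -
  have B': "B \<in> relatively_compact_borel quadrant"
    using A B by (auto simp: relatively_compact_borel_def)
  have *: "set_integrable M B g"
    if M: "sets M = sets borel" "\<And>K. compact K \<Longrightarrow> emeasure M K < \<infinity>" for M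
  proof (rule relatively_compact_borel_set_integrable[OF B' M(1)])
    show "set_integrable M K g" if "compact K" "K \<subseteq> quadrant" for K
      using that by (intro set_integrable_continuous_on_compact continuous_on_subset[OF g] M)
  qed
  show "set_integrable lborel B g" "set_integrable (diagonal_arc_length \<alpha>) B g"
    using *[OF sets_lborel emeasure_compact_finite]
      *[OF sets_diagonal_arc_length emeasure_diagonal_arc_length_compact] by blast+
qed

text \<open>\<open>A\<close> may touch the axes, so its trace need not be relatively compact in the
  open quadrant and uniqueness cannot be applied to it directly. The integral is computed for the
  explicit density, where finite length near the origin gives integrability, and is then transferred
  between the set functions.\<close>

lemma signed_integral_distr_deriv2:
  assumes \<alpha>: "\<alpha> > 0" and A: "A \<in> relatively_compact_borel quadrant"
    and g: "continuous_on quadrant g"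
  shows "signed_integral open_quadrant (distr_deriv2 open_quadrant (payoff \<alpha>) i j)
      (\<lambda>x. indicator (A \<inter> open_quadrant) x * g x) =
    distr_density \<alpha> i j * (LINT x:A \<inter> open_quadrant|diagonal_arc_length \<alpha>. g x)"
proof -
  let ?k = "distr_density \<alpha> i j" and ?F = "\<lambda>x. indicator (A \<inter> open_quadrant) x * g x"
  have [measurable]: "A \<in> sets borel"
    using A by (simp add: relatively_compact_borel_def)
  \<comment> \<open>\<open>g\<close> is continuous on the quadrant only; extension by zero gives
    global measurability.\<close>
  have "(\<lambda>x. indicator quadrant x *\<^sub>R g x) \<in> borel_measurable borel"
    using g by (intro borel_measurable_continuous_on_indicator) auto
  then have "(\<lambda>x. indicator (A \<inter> open_quadrant) x * (indicator quadrant x *\<^sub>R g x))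
      \<in> borel_measurable borel"
    by measurable
  moreover have "(\<lambda>x. indicator (A \<inter> open_quadrant) x * (indicator quadrant x *\<^sub>R g x)) = ?F"
    using open_quadrant_subset by (auto simp: fun_eq_iff indicator_def)
  ultimately have F: "?F \<in> borel_measurable borel"
    by (simp only:)
  have eq: "(\<lambda>x. indicator open_quadrant x *\<^sub>R (?k * ?F x)) =
      (\<lambda>x. ?k * (indicator (A \<inter> open_quadrant) x *\<^sub>R g x))"
    by (auto split: split_indicator)
  have "set_integrable (diagonal_arc_length \<alpha>) (A \<inter> open_quadrant) g"
    using A g by (intro relatively_compact_quadrant_integrable) auto
  then have "set_integrable (diagonal_arc_length \<alpha>) open_quadrant (\<lambda>x. ?k * ?F x)"
    unfolding set_integrable_def eq by simp
  then have signed: "has_signed_integral open_quadrant (\<lambda>A. LINT x:A|diagonal_arc_length \<alpha>. ?k) ?F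
      (LINT x:open_quadrant|diagonal_arc_length \<alpha>. ?k * ?F x)"
    using sigma_compact_quadrant set_integrable_diagonal_const F
    by (intro has_signed_integral_density) auto
  have eq': "has_signed_integral open_quadrant (\<lambda>A. LINT x:A|diagonal_arc_length \<alpha>. ?k) =
      has_signed_integral open_quadrant (distr_deriv2 open_quadrant (payoff \<alpha>) i j)"
    by (intro has_signed_integral_cong is_distr_deriv2_unique[OF open_open_quadrant
          is_distr_deriv2_payoff[OF \<alpha>] is_distr_deriv2_distr_deriv2[OF \<alpha>]])
  have "(LINT x:open_quadrant|diagonal_arc_length \<alpha>. ?k * ?F x) =
      ?k * (LINT x:A \<inter> open_quadrant|diagonal_arc_length \<alpha>. g x)"
    unfolding set_lebesgue_integral_def eq by simp
  with signed have "has_signed_integral open_quadrant (distr_deriv2 open_quadrant (payoff \<alpha>) i j) ?F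
      (?k * (LINT x:A \<inter> open_quadrant|diagonal_arc_length \<alpha>. g x))"
    by (simp only: eq')
  then show ?thesis
    using sigma_compact_quadrant by (intro signed_integral_eqI)
qed

section \<open>Null sets, first derivatives of the payoff, and the density\<close>

lemma AE_hyperplane:
  fixes v :: "'a::euclidean_space"
  assumes "v \<noteq> 0"
  shows "AE x in lborel. v \<bullet> x \<noteq> 0"
proof -
  have "{x. v \<bullet> x = 0} \<in> null_sets lebesgue"
    using assms negligible_hyperplane[of v 0] by (simp add: negligible_iff_null_sets)
  moreover have "{x. v \<bullet> x = 0} \<in> sets borel"
    using closed_hyperplane[of v 0] by auto
  ultimately have "{x. v \<bullet> x = 0} \<in> null_sets lborel"
    by (simp add: null_sets_completion_iff)
  from AE_not_in[OF this] show ?thesis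
    by simp
qed

lemma AE_off_diagonal: "AE x :: real^2 in lborel. x $ 1 \<noteq> \<alpha> * x $ 2"
proof -
  have "diagonal_normal \<alpha> \<noteq> 0"
    by (simp add: diagonal_normal_def vec_eq_iff forall_2)
  then show ?thesis
    using AE_hyperplane[of "diagonal_normal \<alpha>"]
    by (simp add: diagonal_normal_def inner_vec_def sum_2)
qed

lemma AE_off_axes: "AE x in lborel. x \<in> quadrant \<longrightarrow> x \<in> open_quadrant"
proof -
  have "AE x :: real^2 in lborel. x $ i \<noteq> 0" for i
    using AE_hyperplane[of "axis i 1 :: real^2"] by (simp add: inner_axis' axis_eq_0_iff)
  from this[of 1] this[of 2] show ?thesis
    by eventually_elim (auto simp: quadrant_def open_quadrant_def forall_2)
qed

lemma diagonal_borel [measurable]: "diagonal \<alpha> \<in> sets borel"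
  by (simp add: diagonal_def)

lemma diagonal_null: "diagonal \<alpha> \<in> null_sets lborel"
  using AE_off_diagonal[of \<alpha>]
  by (subst AE_iff_null_sets) (auto simp: diagonal_def elim!: eventually_mono)

text \<open>\<open>payoff (x + h) = payoff x + payoff h\<close> for \<open>x\<close> on the line through the diagonal, so all points
  of that line share the same junk value of the derivative; hence \<open>partial i (payoff \<alpha>)\<close> is Borel.\<close>

lemma partial_payoff:
  "partial i (payoff \<alpha>) x =
    (if x $ 1 > \<alpha> * x $ 2 then axis 1 1 $ i
     else if x $ 1 < \<alpha> * x $ 2 then \<alpha> * axis 2 1 $ i
     else partial i (payoff \<alpha>) 0)"
proof (cases "x $ 1" "\<alpha> * x $ 2" rule: linorder_cases)
  case greater
  have "((\<lambda>x. x $ 1) has_derivative (\<lambda>h. h $ 1)) (at x)"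
    by (intro bounded_linear_imp_has_derivative bounded_linear_vec_nth)
  moreover have "open {x. \<alpha> * x $ 2 < x $ 1}"
    by (intro open_Collect_less continuous_intros)
  ultimately have "(payoff \<alpha> has_derivative (\<lambda>h. h $ 1)) (at x)"
    by (rule has_derivative_transform_within_open) (use greater in \<open>auto simp: payoff_def\<close>)
  from partial_eqI[OF this] greater show ?thesis
    by (auto simp: axis_def)
next
  case less
  have "((\<lambda>x. \<alpha> * x $ 2) has_derivative (\<lambda>h. \<alpha> * h $ 2)) (at x)"
    by (intro has_derivative_mult_right bounded_linear_imp_has_derivative bounded_linear_vec_nth)
  moreover have "open {x. x $ 1 < \<alpha> * x $ 2}"
    by (intro open_Collect_less continuous_intros)
  ultimately have "(payoff \<alpha> has_derivative (\<lambda>h. \<alpha> * h $ 2)) (at x)"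
    by (rule has_derivative_transform_within_open) (use less in \<open>auto simp: payoff_def\<close>)
  from partial_eqI[OF this] less show ?thesis
    by (auto simp: axis_def)
next
  case equal
  then have "payoff \<alpha> (x + h) - payoff \<alpha> x = payoff \<alpha> (0 + h) - payoff \<alpha> 0" for h
    by (simp add: payoff_def algebra_simps max_def)
  then have "(payoff \<alpha> has_derivative f') (at x) \<longleftrightarrow> (payoff \<alpha> has_derivative f') (at 0)" for f'
    by (simp add: has_derivative_at)
  then show ?thesis
    using equal by (simp add: partial_def frechet_derivative_def)
qed

lemma borel_measurable_partial_payoff [measurable]: "partial i (payoff \<alpha>) \<in> borel_measurable borel"
  by (subst partial_payoff[abs_def]) measurable

lemma locally_lipschitz_on_continuous: "locally_lipschitz_on S f \<Longrightarrow> continuous_on S f"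
  unfolding locally_lipschitz_on_def by (rule local_lipschitz_continuous_on) auto

lemma continuous_on_diffusion_matrix:
  assumes "continuous_on S \<sigma>"
  shows "continuous_on S (\<lambda>x. diffusion_matrix \<sigma> x $ i $ j)"
  using assms unfolding diffusion_matrix_def matrix_matrix_mult_def transpose_def
  by (simp, intro continuous_intros)

lemma normal_form_eq:
  "normal_form \<alpha> a x =
    (\<Sum>i\<in>UNIV. \<Sum>j\<in>UNIV. diagonal_normal \<alpha> $ i * diagonal_normal \<alpha> $ j * a x $ i $ j)"
  by (simp add: normal_form_def inner_vec_def matrix_vector_mult_def sum_distrib_left ac_simps)

lemma continuous_on_normal_form:
  assumes "\<And>i j. continuous_on S (\<lambda>x. a x $ i $ j)"
  shows "continuous_on S (normal_form \<alpha> a)"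
  unfolding normal_form_eq[abs_def]
  by (intro continuous_on_sum continuous_on_mult continuous_on_const assms)

lemma ac_density_eq:
  "ac_density \<alpha> \<mu> c r x =
    indicator {x. x $ 1 > \<alpha> * x $ 2} x * (c x + r * x $ 1 - \<mu> x $ 1)
    + indicator {x. x $ 1 < \<alpha> * x $ 2} x * (c x + r * \<alpha> * x $ 2 - \<alpha> * \<mu> x $ 2)"
  by (auto simp: ac_density_def)

text \<open>The density may jump across the diagonal, but each branch is continuous on the whole
  closed quadrant, so both claims are obtained branch by branch.\<close>

lemma
  assumes \<mu>: "continuous_on quadrant \<mu>" and c: "continuous_on quadrant c"
  shows set_integrable_ac_density:
      "A \<in> relatively_compact_borel quadrant \<Longrightarrow> set_integrable lborel A (ac_density \<alpha> \<mu> c r)"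
    and borel_measurable_ac_density:
      "(\<lambda>x. indicator quadrant x * ac_density \<alpha> \<mu> c r x) \<in> borel_measurable borel"
proof -
  let ?u = "\<lambda>x. c x + r * x $ 1 - \<mu> x $ 1" and ?v = "\<lambda>x. c x + r * \<alpha> * x $ 2 - \<alpha> * \<mu> x $ 2"
  let ?R1 = "{x::real^2. x $ 1 > \<alpha> * x $ 2}" and ?R2 = "{x::real^2. x $ 1 < \<alpha> * x $ 2}"
  have R [measurable]: "?R1 \<in> sets borel" "?R2 \<in> sets borel"
    by measurable
  have cont: "continuous_on quadrant ?u" "continuous_on quadrant ?v"
    using \<mu> c by (auto intro!: continuous_intros)
  have eq: "indicator S x *\<^sub>R ac_density \<alpha> \<mu> c r x =
      indicator ?R1 x *\<^sub>R (indicator S x *\<^sub>R ?u x) + indicator ?R2 x *\<^sub>R (indicator S x *\<^sub>R ?v x)"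
    for S x
    by (simp add: ac_density_eq algebra_simps)
  show "set_integrable lborel A (ac_density \<alpha> \<mu> c r)"
    if A: "A \<in> relatively_compact_borel quadrant"
  proof -
    have "A \<in> sets borel"
      using A by (simp add: relatively_compact_borel_def)
    then have uv: "set_integrable lborel A ?u" "set_integrable lborel A ?v"
      using A cont by (auto intro: relatively_compact_quadrant_integrable)
    show ?thesis
      unfolding set_integrable_def eq
      by (rule Bochner_Integration.integrable_add; rule integrable_mult_indicator)
        (use uv R in \<open>simp_all add: set_integrable_def\<close>)
  qed
  have m: "(\<lambda>x. indicator quadrant x *\<^sub>R ?u x) \<in> borel_measurable borel"
    "(\<lambda>x. indicator quadrant x *\<^sub>R ?v x) \<in> borel_measurable borel"
    using cont[THEN borel_measurable_continuous_on_indicator[OF quadrant_borel(1)]] by simp_all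
  have "(\<lambda>x. indicator quadrant x *\<^sub>R ac_density \<alpha> \<mu> c r x) \<in> borel_measurable borel"
    unfolding eq by (intro borel_measurable_add borel_measurable_scaleR borel_measurable_indicator R m)
  then show "(\<lambda>x. indicator quadrant x * ac_density \<alpha> \<mu> c r x) \<in> borel_measurable borel"
    by simp
qed

section \<open>The decomposition\<close>

lemma ac_density_AE:
  "AE x in lborel. c x + r * payoff \<alpha> x - (\<Sum>i\<in>UNIV. \<mu> x $ i * partial i (payoff \<alpha>) x) =
     ac_density \<alpha> \<mu> c r x"
  using AE_off_diagonal[of \<alpha>]
proof eventually_elim
  case (elim x)
  then show ?case
    by (cases "x $ 1" "\<alpha> * x $ 2" rule: linorder_cases)
      (auto simp: sum_2 partial_payoff[of _ \<alpha> x] ac_density_def payoff_def axis_def algebra_simps)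
qed

text \<open>The diagonal and the axes are Lebesgue null, which permits the almost everywhere
  gradient and the passage from the open quadrant back to \<open>A\<close>.\<close>

lemma set_integral_payoff_ac_density:
  assumes A: "A \<in> relatively_compact_borel quadrant"
    and \<mu>: "continuous_on quadrant \<mu>" and c: "continuous_on quadrant c"
  shows "(LINT x:A \<inter> open_quadrant|lborel. c x + r * payoff \<alpha> x)
      - (LINT x:A \<inter> open_quadrant|lborel. \<Sum>i\<in>UNIV. \<mu> x $ i * partial i (payoff \<alpha>) x) =
    (LINT x:A|lborel. ac_density \<alpha> \<mu> c r x)"
proof -
  let ?B = "A \<inter> open_quadrant"
  let ?f = "\<lambda>x. c x + r * payoff \<alpha> x" and ?h = "ac_density \<alpha> \<mu> c r"
  let ?g = "\<lambda>x. \<Sum>i\<in>UNIV. \<mu> x $ i * partial i (payoff \<alpha>) x"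
  have [measurable]: "A \<in> sets borel" and "A \<subseteq> quadrant"
    using A by (auto simp: relatively_compact_borel_def)
  have f: "set_integrable lborel ?B ?f"
    using A c by (intro relatively_compact_quadrant_integrable)
      (auto intro!: continuous_intros continuous_on_payoff)
  have hA: "set_integrable lborel A ?h"
    by (rule set_integrable_ac_density[OF \<mu> c A])
  then have h: "set_integrable lborel ?B ?h"
    by (rule set_integrable_subset) auto
  have [measurable]: "(\<lambda>x. indicator quadrant x *\<^sub>R (\<mu> x $ i)) \<in> borel_measurable borel" for i
    using \<mu> by (intro borel_measurable_continuous_on_indicator continuous_intros) auto
  have g_eq: "(\<lambda>x. indicator ?B x *\<^sub>R ?g x) =
      (\<lambda>x. indicator ?B x * (\<Sum>i\<in>UNIV. (indicator quadrant x *\<^sub>R (\<mu> x $ i)) * partial i (payoff \<alpha>) x))"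
    using \<open>A \<subseteq> quadrant\<close> by (auto simp: fun_eq_iff indicator_def)
  \<comment> \<open>The drift term is replaced by a difference of two integrable functions, so
    measurability is all that has to be checked for it directly.\<close>
  have "(LINT x:?B|lborel. ?g x) = (\<integral>x. indicator ?B x *\<^sub>R ?f x - indicator ?B x *\<^sub>R ?h x \<partial>lborel)"
    unfolding set_lebesgue_integral_def
  proof (rule integral_cong_AE)
    show "(\<lambda>x. indicator ?B x *\<^sub>R ?g x) \<in> borel_measurable lborel"
      unfolding g_eq by measurable
    show "(\<lambda>x. indicator ?B x *\<^sub>R ?f x - indicator ?B x *\<^sub>R ?h x) \<in> borel_measurable lborel"
      using f h unfolding set_integrable_def by (intro borel_measurable_diff) auto
    show "AE x in lborel. indicator ?B x *\<^sub>R ?g x = indicator ?B x *\<^sub>R ?f x - indicator ?B x *\<^sub>R ?h x"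
      using ac_density_AE[of c r \<alpha> \<mu>]
    proof eventually_elim
      case (elim x)
      then have "?g x = ?f x - ?h x"
        by linarith
      then show ?case
        by (simp only: scaleR_diff_right)
    qed
  qed
  also have "\<dots> = (LINT x:?B|lborel. ?f x) - (LINT x:?B|lborel. ?h x)"
    using f h unfolding set_lebesgue_integral_def set_integrable_def
    by (rule Bochner_Integration.integral_diff)
  also have "(LINT x:?B|lborel. ?h x) = (LINT x:A|lborel. ?h x)"
    unfolding set_lebesgue_integral_def
  proof (rule integral_cong_AE)
    show "(\<lambda>x. indicator ?B x *\<^sub>R ?h x) \<in> borel_measurable lborel"
      "(\<lambda>x. indicator A x *\<^sub>R ?h x) \<in> borel_measurable lborel"
      using h hA unfolding set_integrable_def by auto
    show "AE x in lborel. indicator ?B x *\<^sub>R ?h x = indicator A x *\<^sub>R ?h x"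
      using AE_off_axes by eventually_elim (use \<open>A \<subseteq> quadrant\<close> in \<open>auto simp: indicator_def\<close>)
  qed
  finally show ?thesis
    by simp
qed

lemma AE_diagonal_arc_length_diagonal:
  assumes "\<alpha> > 0"
  shows "AE x in diagonal_arc_length \<alpha>. x \<in> diagonal \<alpha> \<and> x \<in> open_quadrant"
  using AE_diagonal_arc_length[of \<alpha>]
  by eventually_elim (use assms in \<open>auto simp: diagonal_def quadrant_def open_quadrant_def forall_2\<close>)

lemma emeasure_diagonal_arc_length_off_diagonal:
  assumes "\<alpha> > 0"
  shows "emeasure (diagonal_arc_length \<alpha>) (- diagonal \<alpha>) = 0"
proof -
  have "- diagonal \<alpha> \<in> null_sets (diagonal_arc_length \<alpha>)"
    using AE_diagonal_arc_length_diagonal[OF assms]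
    by (subst AE_iff_null_sets) (auto elim!: eventually_mono)
  then show ?thesis
    by auto
qed

text \<open>Contracting \<open>n_i n_j\<close> with \<open>a\<close> gives the quadratic form; the
  1/2 of the generator and the norm of \<open>n\<close> make up the constant, and the minus sign is
  already built into \<open>diagonal_part\<close>.\<close>

lemma generator_measure_payoff:
  assumes \<alpha>: "\<alpha> > 0" and A: "A \<in> relatively_compact_borel quadrant"
    and a: "\<And>i j. continuous_on quadrant (\<lambda>x. a x $ i $ j)"
  shows "generator_measure \<mu> a (payoff \<alpha>) A =
    (LINT x:A \<inter> open_quadrant|lborel. \<Sum>i\<in>UNIV. \<mu> x $ i * partial i (payoff \<alpha>) x)
    - diagonal_part \<alpha> a A"
proof -
  let ?M = "diagonal_arc_length \<alpha>" and ?B = "A \<inter> open_quadrant"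
  let ?n = "diagonal_normal \<alpha>"
  have AB [measurable]: "A \<in> sets borel"
    using A by (simp add: relatively_compact_borel_def)
  have int: "set_integrable ?M ?B (\<lambda>x. a x $ i $ j)" for i j
    using A a by (intro relatively_compact_quadrant_integrable) auto
  have nf: "continuous_on quadrant (normal_form \<alpha> a)"
    using a by (rule continuous_on_normal_form)
  have "(\<Sum>i\<in>UNIV. \<Sum>j\<in>UNIV. signed_integral open_quadrant (distr_deriv2 open_quadrant (payoff \<alpha>) i j)
      (\<lambda>x. indicator ?B x * a x $ i $ j)) =
    (\<Sum>i\<in>UNIV. \<Sum>j\<in>UNIV. distr_density \<alpha> i j * (LINT x:?B|?M. a x $ i $ j))"
    using A a by (simp add: signed_integral_distr_deriv2[OF \<alpha>])
  also have "\<dots> = 1 / sqrt (1 + \<alpha>\<^sup>2) *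
      (\<Sum>i\<in>UNIV. \<Sum>j\<in>UNIV. ?n $ i * ?n $ j * (LINT x:?B|?M. a x $ i $ j))"
    by (simp add: distr_density_def sum_distrib_left)
  also have "(\<Sum>i\<in>UNIV. \<Sum>j\<in>UNIV. ?n $ i * ?n $ j * (LINT x:?B|?M. a x $ i $ j)) =
      (LINT x:?B|?M. normal_form \<alpha> a x)"
  proof -
    have "(LINT x:?B|?M. normal_form \<alpha> a x) =
        (\<integral>x. (\<Sum>i\<in>UNIV. \<Sum>j\<in>UNIV. ?n $ i * ?n $ j * (indicator ?B x *\<^sub>R (a x $ i $ j))) \<partial>?M)"
      unfolding set_lebesgue_integral_def
      by (intro Bochner_Integration.integral_cong) (simp_all add: normal_form_eq sum_distrib_left ac_simps)
    also have "\<dots> = (\<Sum>i\<in>UNIV. \<Sum>j\<in>UNIV. ?n $ i * ?n $ j * (LINT x:?B|?M. a x $ i $ j))"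
      using int unfolding set_integrable_def set_lebesgue_integral_def
      by (simp add: Bochner_Integration.integral_sum)
    finally show ?thesis
      by simp
  qed
  \<comment> \<open>Arc-length almost every point lies both on the diagonal and in the open
    quadrant, so the two domains are interchangeable.\<close>
  also have "(LINT x:?B|?M. normal_form \<alpha> a x) = (LINT x:A \<inter> diagonal \<alpha>|?M. normal_form \<alpha> a x)"
    unfolding set_lebesgue_integral_def
  proof (rule integral_cong_AE)
    have "set_integrable ?M ?B (normal_form \<alpha> a)" "set_integrable ?M (A \<inter> diagonal \<alpha>) (normal_form \<alpha> a)"
      using A nf by (auto intro: relatively_compact_quadrant_integrable)
    then show "(\<lambda>x. indicator ?B x *\<^sub>R normal_form \<alpha> a x) \<in> borel_measurable ?M"
      "(\<lambda>x. indicator (A \<inter> diagonal \<alpha>) x *\<^sub>R normal_form \<alpha> a x) \<in> borel_measurable ?M"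
      unfolding set_integrable_def by auto
    show "AE x in ?M. indicator ?B x *\<^sub>R normal_form \<alpha> a x =
        indicator (A \<inter> diagonal \<alpha>) x *\<^sub>R normal_form \<alpha> a x"
      using AE_diagonal_arc_length_diagonal[OF \<alpha>] by eventually_elim (simp add: indicator_def)
  qed
  finally show ?thesis
    by (simp add: generator_measure_def diagonal_part_def)
qed

text \<open>Absorbing the constant and the restriction to the diagonal into a density brings the
  general results on densities to bear.\<close>

lemma diagonal_part_eq:
  "diagonal_part \<alpha> a = (\<lambda>A. LINT x:A|diagonal_arc_length \<alpha>.
     - (1 / (2 * sqrt (1 + \<alpha>\<^sup>2))) * (indicator (diagonal \<alpha>) x * normal_form \<alpha> a x))"
proof
  fix A
  let ?k = "- (1 / (2 * sqrt (1 + \<alpha>\<^sup>2)))"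
  have "(\<lambda>x. indicator A x *\<^sub>R (?k * (indicator (diagonal \<alpha>) x * normal_form \<alpha> a x))) =
      (\<lambda>x. ?k * (indicator (A \<inter> diagonal \<alpha>) x *\<^sub>R normal_form \<alpha> a x))"
    by (auto simp: fun_eq_iff indicator_def)
  then show "diagonal_part \<alpha> a A = (LINT x:A|diagonal_arc_length \<alpha>.
      ?k * (indicator (diagonal \<alpha>) x * normal_form \<alpha> a x))"
    unfolding diagonal_part_def set_lebesgue_integral_def by (simp only: integral_mult_right_zero)
qed

lemma
  assumes nf: "continuous_on quadrant (normal_form \<alpha> a)"
  shows signed_radon_on_diagonal_part: "signed_radon_on quadrant (diagonal_part \<alpha> a)"
    and has_signed_integral_diagonal_part: "F \<in> borel_measurable borel \<Longrightarrow>
      has_signed_integral quadrant (diagonal_part \<alpha> a) F I \<longleftrightarrow>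
        set_integrable (diagonal_arc_length \<alpha>) (diagonal \<alpha>) (\<lambda>x. F x * normal_form \<alpha> a x) \<and>
        I = - (1 / (2 * sqrt (1 + \<alpha>\<^sup>2))) *
          (LINT x:diagonal \<alpha>|diagonal_arc_length \<alpha>. F x * normal_form \<alpha> a x)"
proof -
  let ?M = "diagonal_arc_length \<alpha>"
  let ?k = "- (1 / (2 * sqrt (1 + \<alpha>\<^sup>2)))"
  let ?h = "\<lambda>x. ?k * (indicator (diagonal \<alpha>) x * normal_form \<alpha> a x)"
  \<comment> \<open>Needed for the equivalence: integrability of \<open>?k\<close> times a function
    gives that of the function once \<open>?k\<close> can be divided out.\<close>
  have k: "?k \<noteq> 0"
    using real_sqrt_gt_zero[of "1 + \<alpha>\<^sup>2"] by (simp add: add_nonneg_eq_0_iff)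
  have sub: "diagonal \<alpha> \<subseteq> quadrant"
    by (auto simp: diagonal_def)
  have "(\<lambda>x. indicator (diagonal \<alpha>) x *\<^sub>R normal_form \<alpha> a x) \<in> borel_measurable borel"
    using nf sub by (intro borel_measurable_continuous_on_indicator) (auto intro: continuous_on_subset)
  then have [measurable]: "(\<lambda>x. indicator (diagonal \<alpha>) x * normal_form \<alpha> a x) \<in> borel_measurable borel"
    by simp
  have meas: "(\<lambda>x. indicator quadrant x * ?h x) \<in> borel_measurable borel"
    by measurable
  have int: "set_integrable ?M K ?h" if "compact K" "K \<subseteq> quadrant" for K
  proof -
    have i: "set_integrable ?M K (normal_form \<alpha> a)"
      using that by (intro set_integrable_continuous_on_compact continuous_on_subset[OF nf]
          emeasure_diagonal_arc_length_compact) auto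
    have "integrable ?M (\<lambda>x. ?k * (indicator (diagonal \<alpha>) x *\<^sub>R (indicator K x *\<^sub>R normal_form \<alpha> a x)))"
      by (rule integrable_mult_right, rule integrable_mult_indicator)
        (use i in \<open>simp_all add: set_integrable_def\<close>)
    then show ?thesis
      unfolding set_integrable_def by (simp add: ac_simps)
  qed
  note density = sigma_compact_quadrant(1) sets_diagonal_arc_length meas int
  show "signed_radon_on quadrant (diagonal_part \<alpha> a)"
    unfolding diagonal_part_eq by (rule signed_radon_on_density[OF density])
  assume F: "F \<in> borel_measurable borel"
  have eq: "(\<lambda>x. indicator quadrant x *\<^sub>R (?h x * F x)) =
      (\<lambda>x. ?k * (indicator (diagonal \<alpha>) x *\<^sub>R (F x * normal_form \<alpha> a x)))"
    using sub by (auto simp: fun_eq_iff indicator_def)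
  have iff: "has_signed_integral quadrant (\<lambda>A. LINT x:A|?M. ?h x) F I \<longleftrightarrow>
      set_integrable ?M quadrant (\<lambda>x. ?h x * F x) \<and> I = (LINT x:quadrant|?M. ?h x * F x)"
    by (rule has_signed_integral_density_iff[OF density F])
  show "has_signed_integral quadrant (diagonal_part \<alpha> a) F I \<longleftrightarrow>
      set_integrable ?M (diagonal \<alpha>) (\<lambda>x. F x * normal_form \<alpha> a x) \<and>
      I = ?k * (LINT x:diagonal \<alpha>|?M. F x * normal_form \<alpha> a x)"
    unfolding diagonal_part_eq iff
    unfolding set_integrable_def set_lebesgue_integral_def eq
    unfolding integrable_mult_left_iff integral_mult_right_zero using k by blast
qed

theorem theorem3p10:
  fixes \<mu> :: "real^2 \<Rightarrow> real^2" and \<sigma> :: "real^2 \<Rightarrow> real^2^2" and c :: "real^2 \<Rightarrow> real"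
    and \<alpha> r :: real
  assumes "\<alpha> > 0" and "r > 0"
    and "locally_lipschitz_on quadrant \<mu>" and "linear_growth_on quadrant \<mu>"
    and "locally_lipschitz_on quadrant \<sigma>" and "linear_growth_on quadrant \<sigma>"
    and "locally_uniformly_elliptic_on open_quadrant (diffusion_matrix \<sigma>)"
    and "continuous_on quadrant c" and "\<And>x. x \<in> quadrant \<Longrightarrow> c x \<ge> 0"
  shows
    \<comment> \<open>the second derivatives are signed Radon measures, and so is the stopping gain\<close>
    "(\<forall>i j. is_distr_deriv2 open_quadrant (payoff \<alpha>) i j
              (distr_deriv2 open_quadrant (payoff \<alpha>) i j)) \<and>
     signed_radon_on quadrant (stopping_gain \<mu> (diffusion_matrix \<sigma>) c r (payoff \<alpha>)) \<and>
     signed_radon_on quadrant (diagonal_part \<alpha> (diffusion_matrix \<sigma>)) \<and>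
     \<comment> \<open>decomposition\<close>
     (\<forall>A \<in> relatively_compact_borel quadrant.
        set_integrable lborel A (ac_density \<alpha> \<mu> c r) \<and>
        set_integrable (diagonal_arc_length \<alpha>) (A \<inter> diagonal \<alpha>) (normal_form \<alpha> (diffusion_matrix \<sigma>)) \<and>
        stopping_gain \<mu> (diffusion_matrix \<sigma>) c r (payoff \<alpha>) A =
          (LINT x:A|lborel. ac_density \<alpha> \<mu> c r x) + diagonal_part \<alpha> (diffusion_matrix \<sigma>) A) \<and>
     \<comment> \<open>the diagonal component is singular and carried by the diagonal\<close>
     diagonal \<alpha> \<in> null_sets lborel \<and>
     emeasure (diagonal_arc_length \<alpha>) (- diagonal \<alpha>) = 0 \<and>
     \<comment> \<open>integrals against the diagonal component; one side is defined iff the other is\<close>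
     (\<forall>F \<in> borel_measurable borel. bounded (F ` quadrant) \<longrightarrow>
        (\<forall>I. has_signed_integral quadrant (diagonal_part \<alpha> (diffusion_matrix \<sigma>)) F I \<longleftrightarrow>
           set_integrable (diagonal_arc_length \<alpha>) (diagonal \<alpha>) (\<lambda>x. F x * normal_form \<alpha> (diffusion_matrix \<sigma>) x) \<and>
           I = - (1 / (2 * sqrt (1 + \<alpha>\<^sup>2))) *
                 (LINT x:diagonal \<alpha>|diagonal_arc_length \<alpha>. F x * normal_form \<alpha> (diffusion_matrix \<sigma>) x)))"
proof -
  let ?a = "diffusion_matrix \<sigma>"
  have \<mu>: "continuous_on quadrant \<mu>"
    using assms(3) by (rule locally_lipschitz_on_continuous)
  have a: "continuous_on quadrant (\<lambda>x. ?a x $ i $ j)" for i j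
    using assms(5) by (intro continuous_on_diffusion_matrix locally_lipschitz_on_continuous)
  have nf: "continuous_on quadrant (normal_form \<alpha> ?a)"
    using a by (rule continuous_on_normal_form)
  have decomp: "stopping_gain \<mu> ?a c r (payoff \<alpha>) A =
      (LINT x:A|lborel. ac_density \<alpha> \<mu> c r x) + diagonal_part \<alpha> ?a A"
    if "A \<in> relatively_compact_borel quadrant" for A
    using set_integral_payoff_ac_density[OF that \<mu> assms(8), of r \<alpha>]
    by (simp add: stopping_gain_def generator_measure_payoff[OF assms(1) that a])
  have "signed_radon_on quadrant (\<lambda>A. LINT x:A|lborel. ac_density \<alpha> \<mu> c r x)"
  proof (rule signed_radon_on_density[OF sigma_compact_quadrant(1) sets_lborel
        borel_measurable_ac_density[OF \<mu> assms(8)]])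
    show "set_integrable lborel K (ac_density \<alpha> \<mu> c r)" if "compact K" "K \<subseteq> quadrant" for K
      using that by (intro set_integrable_ac_density[OF \<mu> assms(8)])
        (auto simp: relatively_compact_borel_def borel_compact)
  qed
  \<comment> \<open>The decomposition on relatively compact sets suffices, since the values
    elsewhere do not enter the notion.\<close>
  then have gain: "signed_radon_on quadrant (stopping_gain \<mu> ?a c r (payoff \<alpha>))"
    using signed_radon_on_diagonal_part[OF nf] decomp by (rule signed_radon_on_add)
  have arc: "set_integrable (diagonal_arc_length \<alpha>) (A \<inter> diagonal \<alpha>) (normal_form \<alpha> ?a)"
    if "A \<in> relatively_compact_borel quadrant" for A
    using that nf
    by (intro relatively_compact_quadrant_integrable[OF that])
      (auto simp: relatively_compact_borel_def)
  show ?thesis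
    using is_distr_deriv2_distr_deriv2[OF assms(1)] gain signed_radon_on_diagonal_part[OF nf]
      set_integrable_ac_density[OF \<mu> assms(8)] arc decomp diagonal_null
      emeasure_diagonal_arc_length_off_diagonal[OF assms(1)]
      has_signed_integral_diagonal_part[OF nf]
    by (intro conjI allI ballI impI) blast+
qed

end
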